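(* For each integer $n\ge 2$ let $(x_k)_{k\ge 0}$ be the repeated averaging chain on $\mathbf{R}^n$ started from $x_0=(1,0,\ldots,0)$, and let $T(k)=\sum_{i=1}^n |x_{k,i}-\tfrac1n|$. Let $\Phi:\mathbf{R}\to[0,1]$ be the cumulative distribution function of the standard normal distribution $\mathcal{N}(0,1)$. Then for every $a\in\mathbf{R}$, as $n\to\infty$, \[ T\bigl(\lfloor n(\log_2(n)+a\sqrt{\log_2(n)})/2\rfloor\bigr)\to 2\Phi(-a)\quad\text{in probability.} \]
   Context: Repeated averaging chain on $\mathbf{R}^n$: given $x_k=(x_{k,1},\ldots,x_{k,n})$, pick a pair of distinct indices $I,J\in\{1,\ldots,n\}$ uniformly at random (independently of the past), replace both $x_{k,I}$ and $x_{k,J}$ by $(x_{k,I}+x_{k,J})/2$, and keep all other coordinates the same; the result is $x_{k+1}$. For fixed $a$ only $n$ large enough that the time index is nonnegative is considered. *)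

theory Defs
  imports "HOL-Probability.Probability"
begin

text \<open>
  A vector of \<open>\<real>\<^sup>n\<close> is a function \<open>nat \<Rightarrow> real\<close> of which only the coordinates \<open>1, \<dots>, n\<close> matter.
\<close>

definition distinct_pairs :: "nat \<Rightarrow> (nat \<times> nat) set" where
  "distinct_pairs n = {(i, j). i \<in> {1..n} \<and> j \<in> {1..n} \<and> i \<noteq> j}"

definition average_pair :: "nat \<times> nat \<Rightarrow> (nat \<Rightarrow> real) \<Rightarrow> nat \<Rightarrow> real" where
  "average_pair p x = (case p of (i, j) \<Rightarrow> x(i := (x i + x j) / 2, j := (x i + x j) / 2))"

text \<open>
  \<open>P k\<close> is the pair \<open>(I, J)\<close> picked in passing from time \<open>k\<close> to time \<open>k + 1\<close>. The starting
  point is deterministic, so that independence of each pick from the past is the mutual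
  independence of the picks. For \<open>n < 2\<close> there are no distinct pairs and the notion is not
  meaningful.
\<close>

definition repeated_averaging_chain ::
  "nat \<Rightarrow> (nat \<Rightarrow> real) \<Rightarrow> 'a measure \<Rightarrow> (nat \<Rightarrow> 'a \<Rightarrow> nat \<Rightarrow> real) \<Rightarrow> bool" where
  "repeated_averaging_chain n x0 M X \<longleftrightarrow>
     prob_space M \<and>
     (\<exists>P :: nat \<Rightarrow> 'a \<Rightarrow> nat \<times> nat.
        prob_space.indep_vars M (\<lambda>_. count_space UNIV) P UNIV \<and>
        (\<forall>k. distr M (count_space UNIV) (P k) = measure_pmf (pmf_of_set (distinct_pairs n))) \<and>
        (\<forall>\<omega>\<in>space M. X 0 \<omega> = x0) \<and>
        (\<forall>k. \<forall>\<omega>\<in>space M. X (Suc k) \<omega> = average_pair (P k \<omega>) (X k \<omega>)))"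

definition start_vector :: "nat \<Rightarrow> real" where
  "start_vector i = (if i = 1 then 1 else 0)"

definition l1_dist_uniform :: "nat \<Rightarrow> (nat \<Rightarrow> real) \<Rightarrow> real" where
  "l1_dist_uniform n x = (\<Sum>i = 1..n. \<bar>x i - 1 / real n\<bar>)"

text \<open>
  Convergence in probability to a constant; the variables may live on different probability
  spaces.
\<close>

definition tendsto_in_probability ::
  "(nat \<Rightarrow> 'a measure) \<Rightarrow> (nat \<Rightarrow> 'a \<Rightarrow> real) \<Rightarrow> real \<Rightarrow> bool" where
  "tendsto_in_probability M Y c \<longleftrightarrow>
     (\<forall>\<epsilon>>0. (\<lambda>n. measure (M n) {\<omega> \<in> space (M n). \<bar>Y n \<omega> - c\<bar> > \<epsilon>}) \<longlonglongrightarrow> 0)"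

text \<open>
  For fixed \<open>a\<close> the integer below is nonnegative for all large \<open>n\<close>, so that the truncation
  by \<open>nat\<close> plays no role in the limit.
\<close>

definition averaging_time :: "real \<Rightarrow> nat \<Rightarrow> nat" where
  "averaging_time a n =
     nat \<lfloor>real n * (log 2 (real n) + a * sqrt (log 2 (real n))) / 2\<rfloor>"

end

(*
  A random piece of the unit mass has been averaged N ~ Bin(k, 2/n) times by time k, and the
  coordinate where it sits has value at least 2^(-N). At time k = averaging_time a n the central
  limit theorem says that N < log2 n - delta sqrt(log2 n) has probability about Phi(-a); such mass
  sits at coordinates with value far above 1/n, so it occupies o(n) of them and forces
  T >= 2 Phi(-a) - o(1) in mean. Smoothing the cutoff of N at scale sqrt(log2 n) makes the amount of
  that mass a Lipschitz statistic whose variance is O(1/log2 n), so the lower bound holds with high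
  probability.

  For the upper bound stop slightly earlier, at averaging_time (a - delta) n. The mass with N above
  log2 n - (delta/2) sqrt(log2 n) has squared l2 norm at most 2^((delta/2) sqrt(log2 n) + O(1)) / n in
  mean, and the remaining (delta/2) n sqrt(log2 n) steps contract the squared l2 distance to uniform
  by exp(-(delta/2) sqrt(log2 n)), which wins because ln 2 < 1. The other mass, about Phi(-a),
  contributes at most twice its amount. Hence limsup E T <= 2 Phi(-a), and together with the lower
  bound this gives convergence in probability.
*)
theory Submission
  imports Defs
begin

section \<open>Means over one uniform pair and over several independent ones, as finite sums\<close>

section \<open>Averages over picks\<close>

definition pair_mean :: "nat \<Rightarrow> (nat \<times> nat \<Rightarrow> real) \<Rightarrow> real" where
  "pair_mean n F = (\<Sum>p\<in>distinct_pairs n. F p) / real (card (distinct_pairs n))"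

text \<open>A list of picks has the most recent pick at its head.\<close>

definition path_mean :: "nat \<Rightarrow> nat \<Rightarrow> ((nat \<times> nat) list \<Rightarrow> real) \<Rightarrow> real" where
  "path_mean n k F =
     (\<Sum>ps | set ps \<subseteq> distinct_pairs n \<and> length ps = k. F ps) / real (card (distinct_pairs n)) ^ k"

lemma distinct_pairs_eq: "distinct_pairs n = (SIGMA i:{1..n}. {1..n} - {i})"
  by (auto simp: distinct_pairs_def)

lemma finite_distinct_pairs [simp]: "finite (distinct_pairs n)"
  by (simp add: distinct_pairs_eq)

lemma sum_distinct_pairs:
  fixes F :: "nat \<Rightarrow> nat \<Rightarrow> real"
  shows "(\<Sum>p\<in>distinct_pairs n. F (fst p) (snd p)) = (\<Sum>i=1..n. \<Sum>j=1..n. F i j) - (\<Sum>i=1..n. F i i)"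
proof -
  have "(\<Sum>p\<in>distinct_pairs n. F (fst p) (snd p)) = (\<Sum>i=1..n. \<Sum>j\<in>{1..n} - {i}. F i j)"
    unfolding distinct_pairs_eq by (subst sum.Sigma) (auto simp: case_prod_unfold)
  also have "\<dots> = (\<Sum>i=1..n. (\<Sum>j=1..n. F i j) - F i i)"
    by (intro sum.cong refl) (simp add: sum_diff1)
  finally show ?thesis by (simp add: sum_subtractf)
qed

lemma card_distinct_pairs: "real (card (distinct_pairs n)) = real n * (real n - 1)"
  using sum_distinct_pairs[of "\<lambda>_ _. 1" n] by (simp add: algebra_simps)

lemma card_distinct_pairs_pos: "2 \<le> n \<Longrightarrow> 0 < card (distinct_pairs n)"
proof -
  assume "2 \<le> n"
  then have "0 < real (card (distinct_pairs n))" unfolding card_distinct_pairs by simp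
  then show ?thesis by simp
qed

lemma pair_mean_add: "pair_mean n (\<lambda>p. F p + G p) = pair_mean n F + pair_mean n G"
  and pair_mean_diff: "pair_mean n (\<lambda>p. F p - G p) = pair_mean n F - pair_mean n G"
  and pair_mean_cmult: "pair_mean n (\<lambda>p. c * F p) = c * pair_mean n F"
  by (simp_all add: pair_mean_def sum.distrib sum_subtractf sum_distrib_left add_divide_distrib diff_divide_distrib)

lemma pair_mean_const: "2 \<le> n \<Longrightarrow> pair_mean n (\<lambda>_. c) = c"
  using card_distinct_pairs_pos[of n] by (simp add: pair_mean_def card_gt_0_iff)

lemma pair_mean_mono:
  "(\<And>p. p \<in> distinct_pairs n \<Longrightarrow> F p \<le> G p) \<Longrightarrow> pair_mean n F \<le> pair_mean n G"
  unfolding pair_mean_def by (intro divide_right_mono sum_mono) auto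

lemma pair_mean_cong:
  "(\<And>p. p \<in> distinct_pairs n \<Longrightarrow> F p = G p) \<Longrightarrow> pair_mean n F = pair_mean n G"
  unfolding pair_mean_def by (simp cong: sum.cong)

lemma pair_mean_sum:
  assumes "2 \<le> n"
  shows "pair_mean n (\<lambda>p. f (fst p) + f (snd p)) = 2 / n * (\<Sum>i=1..n. f i)"
proof -
  have "(\<Sum>p\<in>distinct_pairs n. f (fst p) + f (snd p)) = 2 * (real n - 1) * (\<Sum>i=1..n. f i)"
    using sum_distinct_pairs[of "\<lambda>i j. f i + f j" n]
    by (simp add: sum.distrib algebra_simps sum_distrib_left)
  then show ?thesis using assms by (simp add: pair_mean_def card_distinct_pairs) (simp add: field_simps)
qed

lemma pair_mean_cross:
  assumes "2 \<le> n"
  shows "pair_mean n (\<lambda>p. f (fst p) * g (snd p) + g (fst p) * f (snd p)) =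
    2 / (real n * (real n - 1)) * ((\<Sum>i=1..n. f i) * (\<Sum>i=1..n. g i) - (\<Sum>i=1..n. f i * g i))"
proof -
  have "(\<Sum>i=1..n. \<Sum>j=1..n. g i * f j) = (\<Sum>i=1..n. f i) * (\<Sum>i=1..n. g i)"
    unfolding sum_product[symmetric] by (rule mult.commute)
  then have "(\<Sum>p\<in>distinct_pairs n. f (fst p) * g (snd p) + g (fst p) * f (snd p)) =
      2 * ((\<Sum>i=1..n. f i) * (\<Sum>i=1..n. g i) - (\<Sum>i=1..n. f i * g i))"
    using sum_distinct_pairs[of "\<lambda>i j. f i * g j + g i * f j" n]
    by (simp add: sum.distrib sum_product[symmetric] sum_distrib_left mult.commute[of "g _" "f _"])
  then show ?thesis using assms by (simp add: pair_mean_def card_distinct_pairs)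
qed

text \<open>One-step variance bound: after expanding, the two sides differ by
  \<open>(pair_mean n d)\<^sup>2\<close>.\<close>

lemma pair_mean_shift_square_le:
  assumes "2 \<le> n"
  shows "pair_mean n (\<lambda>p. (s - d p)\<^sup>2) \<le> (s - pair_mean n d)\<^sup>2 + pair_mean n (\<lambda>p. (d p)\<^sup>2)"
proof -
  have "pair_mean n (\<lambda>p. (s - d p)\<^sup>2) = pair_mean n (\<lambda>p. s\<^sup>2 - 2 * s * d p + (d p)\<^sup>2)"
    by (simp add: power2_diff algebra_simps)
  also have "\<dots> = s\<^sup>2 - 2 * s * pair_mean n d + pair_mean n (\<lambda>p. (d p)\<^sup>2)"
    by (simp only: pair_mean_add pair_mean_diff pair_mean_cmult pair_mean_const[OF assms])
  finally show ?thesis by (simp add: power2_diff)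
qed

lemma finite_paths [simp]: "finite {ps. set ps \<subseteq> distinct_pairs n \<and> length ps = k}"
  by (simp add: finite_lists_length_eq)

lemma path_mean_0: "path_mean n 0 F = F []"
proof -
  have "{ps. set ps \<subseteq> distinct_pairs n \<and> ps = []} = {[]}" by auto
  then show ?thesis by (simp add: path_mean_def)
qed

text \<open>Conditioning on the past: the most recent pick is averaged with the earlier ones
  fixed.\<close>

lemma path_mean_Suc:
  "path_mean n (Suc k) F = path_mean n k (\<lambda>ps. pair_mean n (\<lambda>p. F (p # ps)))"
proof -
  have "(\<Sum>ps | set ps \<subseteq> distinct_pairs n \<and> length ps = Suc k. F ps)
      = (\<Sum>(ps, p)\<in>{ps. set ps \<subseteq> distinct_pairs n \<and> length ps = k} \<times> distinct_pairs n. F (p # ps))"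
    unfolding lists_length_Suc_eq by (subst sum.reindex) (auto simp: inj_on_def case_prod_unfold)
  also have "\<dots> = (\<Sum>ps | set ps \<subseteq> distinct_pairs n \<and> length ps = k. \<Sum>p\<in>distinct_pairs n. F (p # ps))"
    by (subst sum.cartesian_product) simp
  finally show ?thesis
    by (simp add: path_mean_def pair_mean_def sum_divide_distrib[symmetric])
qed

lemma path_mean_add: "path_mean n k (\<lambda>ps. F ps + G ps) = path_mean n k F + path_mean n k G"
  and path_mean_diff: "path_mean n k (\<lambda>ps. F ps - G ps) = path_mean n k F - path_mean n k G"
  and path_mean_cmult: "path_mean n k (\<lambda>ps. c * F ps) = c * path_mean n k F"
  by (simp_all add: path_mean_def sum.distrib sum_subtractf sum_distrib_left add_divide_distrib diff_divide_distrib)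

lemma path_mean_const: "2 \<le> n \<Longrightarrow> path_mean n k (\<lambda>_. c) = c"
  by (induction k) (simp_all add: path_mean_0 path_mean_Suc pair_mean_const)

lemma path_mean_mono:
  "(\<And>ps. set ps \<subseteq> distinct_pairs n \<Longrightarrow> F ps \<le> G ps) \<Longrightarrow> path_mean n k F \<le> path_mean n k G"
  unfolding path_mean_def by (intro divide_right_mono sum_mono) auto

lemma path_mean_cong:
  "(\<And>ps. set ps \<subseteq> distinct_pairs n \<Longrightarrow> F ps = G ps) \<Longrightarrow> path_mean n k F = path_mean n k G"
  unfolding path_mean_def by (intro arg_cong2[where f = "(/)"] sum.cong) auto

text \<open>The \<open>r\<close> later picks stand in front of the list, so they form the inner
  mean, given the first \<open>k\<close>.\<close>

lemma path_mean_append: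
  "path_mean n (r + k) F = path_mean n k (\<lambda>ps. path_mean n r (\<lambda>qs. F (qs @ ps)))"
  by (induction r arbitrary: F) (simp_all add: path_mean_0 path_mean_Suc)

lemma path_mean_sq_le:
  assumes "2 \<le> n"
  shows "(path_mean n k F)\<^sup>2 \<le> path_mean n k (\<lambda>ps. (F ps)\<^sup>2)"
proof -
  let ?c = "path_mean n k F"
  have "path_mean n k (\<lambda>_. 0) \<le> path_mean n k (\<lambda>ps. (F ps)\<^sup>2 + (?c\<^sup>2 - 2 * ?c * F ps))"
  proof (rule path_mean_mono)
    fix ps
    show "0 \<le> (F ps)\<^sup>2 + (?c\<^sup>2 - 2 * ?c * F ps)"
      using zero_le_power2[of "F ps - ?c"] unfolding power2_diff by (simp add: algebra_simps)
  qed
  also have "\<dots> = path_mean n k (\<lambda>ps. (F ps)\<^sup>2) + (?c\<^sup>2 - 2 * ?c * ?c)"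
    by (simp only: path_mean_add path_mean_diff path_mean_cmult path_mean_const[OF assms])
  finally show ?thesis by (simp add: path_mean_const[OF assms] power2_eq_square)
qed

text \<open>A pick alters two coordinates only; every one-step computation with a sum over
  coordinates reduces to this exchange of two terms.\<close>

lemma sum_two_changes:
  fixes f g :: "'b \<Rightarrow> 'c :: ab_group_add"
  assumes "finite A" "i \<in> A" "j \<in> A" "i \<noteq> j" "\<And>l. l \<in> A \<Longrightarrow> l \<noteq> i \<Longrightarrow> l \<noteq> j \<Longrightarrow> f l = g l"
  shows "sum f A = sum g A - (g i + g j) + (f i + f j)"
proof -
  have *: "sum h A = h i + h j + sum h (A - {i} - {j})" for h :: "'b \<Rightarrow> 'c"
    using assms by (simp add: sum.remove[of A i] sum.remove[of "A - {i}" j] add.assoc)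
  have "sum f (A - {i} - {j}) = sum g (A - {i} - {j})"
    using assms(5) by (intro sum.cong) auto
  then show ?thesis unfolding *[of f] *[of g] by (simp add: algebra_simps)
qed

section \<open>Conservation of mass, l1 contraction and exact l2 decay under averaging\<close>

section \<open>The averaging dynamics\<close>

definition run :: "(nat \<Rightarrow> real) \<Rightarrow> (nat \<times> nat) list \<Rightarrow> nat \<Rightarrow> real" where
  "run x ps = foldr average_pair ps x"

lemma run_Nil [simp]: "run x [] = x"
  and run_Cons: "run x (p # ps) = (run x ps)(fst p := (run x ps (fst p) + run x ps (snd p)) / 2,
        snd p := (run x ps (fst p) + run x ps (snd p)) / 2)"
  and run_append: "run x (qs @ ps) = run (run x ps) qs"
  by (simp_all add: run_def average_pair_def case_prod_unfold)

lemma run_add: "run (\<lambda>i. x i + y i) ps = (\<lambda>i. run x ps i + run y ps i)"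
  by (induction ps) (auto simp: run_Cons fun_eq_iff field_simps)

lemma run_const: "run (\<lambda>_. c) ps = (\<lambda>_. c)"
  by (induction ps) (auto simp: run_Cons fun_eq_iff)

lemma distinct_pairsD:
  assumes "p \<in> distinct_pairs n"
  shows "fst p \<in> {1..n}" "snd p \<in> {1..n}" "fst p \<noteq> snd p"
  using assms by (auto simp: distinct_pairs_def)

lemma sum_run:
  assumes "set ps \<subseteq> distinct_pairs n"
  shows "(\<Sum>i=1..n. run x ps i) = (\<Sum>i=1..n. x i)"
  using assms
proof (induction ps)
  case (Cons p ps)
  then have p: "fst p \<in> {1..n}" "snd p \<in> {1..n}" "fst p \<noteq> snd p"
    by (auto dest: distinct_pairsD)
  show ?case
    using Cons p by (subst sum_two_changes[where g = "run x ps" and i = "fst p" and j = "snd p"])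
      (auto simp: run_Cons)
qed simp

text \<open>Triangle inequality: an averaged pair contributes |a + b|, which is at most |a| +
  |b|.\<close>

lemma sum_abs_run_le:
  assumes "set ps \<subseteq> distinct_pairs n"
  shows "(\<Sum>i=1..n. \<bar>run x ps i\<bar>) \<le> (\<Sum>i=1..n. \<bar>x i\<bar>)"
  using assms
proof (induction ps)
  case (Cons p ps)
  then have p: "fst p \<in> {1..n}" "snd p \<in> {1..n}" "fst p \<noteq> snd p"
    by (auto dest: distinct_pairsD)
  have "(\<Sum>i=1..n. \<bar>run x (p # ps) i\<bar>) \<le> (\<Sum>i=1..n. \<bar>run x ps i\<bar>)"
    using p by (subst sum_two_changes[where g = "\<lambda>i. \<bar>run x ps i\<bar>" and i = "fst p" and j = "snd p"])
      (auto simp: run_Cons)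
  then show ?case using Cons by simp
qed simp

text \<open>Averaging a and b lowers the sum of squares by (a - b)^2 / 2. In a zero-sum vector the
  products of distinct coordinates add up to minus the sum of squares, so the mean loss is exactly
  the fraction 1 / (n - 1).\<close>

lemma path_mean_sum_sq_run:
  assumes n: "2 \<le> n" and u: "(\<Sum>i=1..n. u i) = 0"
  shows "path_mean n k (\<lambda>ps. \<Sum>i=1..n. (run u ps i)\<^sup>2) = (1 - 1 / (real n - 1)) ^ k * (\<Sum>i=1..n. (u i)\<^sup>2)"
proof (induction k)
  case (Suc k)
  have "pair_mean n (\<lambda>p. \<Sum>i=1..n. (run u (p # ps) i)\<^sup>2) = (1 - 1 / (real n - 1)) * (\<Sum>i=1..n. (run u ps i)\<^sup>2)"
    if ps: "set ps \<subseteq> distinct_pairs n" for ps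
  proof -
    let ?v = "run u ps" and ?q = "\<Sum>i=1..n. (run u ps i)\<^sup>2"
    have "pair_mean n (\<lambda>p. \<Sum>i=1..n. (run u (p # ps) i)\<^sup>2) =
        pair_mean n (\<lambda>p. ?q - 1/2 * ((?v (fst p))\<^sup>2 + (?v (snd p))\<^sup>2)
          + 1/2 * (?v (fst p) * ?v (snd p) + ?v (fst p) * ?v (snd p)))"
    proof (rule pair_mean_cong)
      fix p assume p: "p \<in> distinct_pairs n"
      show "(\<Sum>i=1..n. (run u (p # ps) i)\<^sup>2) =
          ?q - 1/2 * ((?v (fst p))\<^sup>2 + (?v (snd p))\<^sup>2) + 1/2 * (?v (fst p) * ?v (snd p) + ?v (fst p) * ?v (snd p))"
        using distinct_pairsD[OF p]
        by (subst sum_two_changes[where g = "\<lambda>i. (?v i)\<^sup>2" and i = "fst p" and j = "snd p"])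
          (auto simp: run_Cons power2_eq_square field_simps)
    qed
    also have "\<dots> = ?q - 1/2 * (2 / n * ?q) + 1/2 * (2 / (real n * (real n - 1)) * (0 * 0 - ?q))"
      using sum_run[OF ps, of u] u pair_mean_sum[OF n, of "\<lambda>i. (?v i)\<^sup>2"] pair_mean_cross[OF n, of ?v ?v]
      by (simp only: pair_mean_add pair_mean_diff pair_mean_cmult pair_mean_const[OF n] power2_eq_square)
    also have "\<dots> = (1 - 1 / (real n - 1)) * ?q"
      using n by (simp add: field_simps)
    finally show ?thesis .
  qed
  then have "path_mean n (Suc k) (\<lambda>ps. \<Sum>i=1..n. (run u ps i)\<^sup>2) =
      path_mean n k (\<lambda>ps. (1 - 1 / (real n - 1)) * (\<Sum>i=1..n. (run u ps i)\<^sup>2))"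
    unfolding path_mean_Suc by (rule path_mean_cong)
  then show ?case using Suc by (simp add: path_mean_cmult)
qed (simp add: path_mean_0)

text \<open>Jensen over paths and Cauchy-Schwarz over coordinates turn the l2 decay into an l1
  bound.\<close>

lemma path_mean_sum_abs_run_le:
  assumes n: "2 \<le> n" and u: "(\<Sum>i=1..n. u i) = 0"
  shows "path_mean n k (\<lambda>ps. \<Sum>i=1..n. \<bar>run u ps i\<bar>)
    \<le> sqrt (real n * ((1 - 1 / (real n - 1)) ^ k * (\<Sum>i=1..n. (u i)\<^sup>2)))"
proof (rule real_le_rsqrt)
  have "(path_mean n k (\<lambda>ps. \<Sum>i=1..n. \<bar>run u ps i\<bar>))\<^sup>2
      \<le> path_mean n k (\<lambda>ps. (\<Sum>i=1..n. \<bar>run u ps i\<bar>)\<^sup>2)"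
    by (rule path_mean_sq_le[OF n])
  also have "\<dots> \<le> path_mean n k (\<lambda>ps. real n * (\<Sum>i=1..n. (run u ps i)\<^sup>2))"
  proof (rule path_mean_mono)
    fix ps
    show "(\<Sum>i=1..n. \<bar>run u ps i\<bar>)\<^sup>2 \<le> real n * (\<Sum>i=1..n. (run u ps i)\<^sup>2)"
      using sum_squared_le_sum_of_squares[of "\<lambda>i. \<bar>run u ps i\<bar>" "{1..n}"] by (simp add: mult.commute)
  qed
  finally show "(path_mean n k (\<lambda>ps. \<Sum>i=1..n. \<bar>run u ps i\<bar>))\<^sup>2
      \<le> real n * ((1 - 1 / (real n - 1)) ^ k * (\<Sum>i=1..n. (u i)\<^sup>2))"
    unfolding path_mean_cmult path_mean_sum_sq_run[OF n u] .
qed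

section \<open>Mean, variance and l2 bounds for mass weighted by its halving count\<close>

section \<open>Mass weighted by its number of halvings\<close>

text \<open>
  Follow the unit mass and count, for each piece of it, how often it has been averaged: a piece at
  coordinate \<open>i\<close> with count \<open>m\<close> contributes to \<open>weighted w ps i\<close> with factor \<open>w m\<close>.
\<close>

fun weighted :: "(nat \<Rightarrow> real) \<Rightarrow> (nat \<times> nat) list \<Rightarrow> nat \<Rightarrow> real" where
  "weighted w [] = (\<lambda>i. w 0 * start_vector i)"
| "weighted w (p # ps) =
     (let c = (weighted (\<lambda>m. w (Suc m)) ps (fst p) + weighted (\<lambda>m. w (Suc m)) ps (snd p)) / 2
      in (weighted w ps)(fst p := c, snd p := c))"

lemma weighted_one: "weighted (\<lambda>_. 1) ps = run start_vector ps"
  by (induction ps) (auto simp: run_Cons Let_def)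

lemma weighted_add: "weighted (\<lambda>m. w m + v m) ps i = weighted w ps i + weighted v ps i"
  by (induction ps arbitrary: w v i) (simp_all add: Let_def field_simps)

lemma weighted_cmult: "weighted (\<lambda>m. c * w m) ps i = c * weighted w ps i"
  by (induction ps arbitrary: w i) (simp_all add: Let_def field_simps)

lemma weighted_diff: "weighted (\<lambda>m. w m - v m) ps i = weighted w ps i - weighted v ps i"
  using weighted_add[of w "\<lambda>m. - 1 * v m" ps i] weighted_cmult[of "- 1" v ps i] by simp

lemma weighted_mono: "(\<And>m. w m \<le> v m) \<Longrightarrow> weighted w ps i \<le> weighted v ps i"
  by (induction ps arbitrary: w v i)
    (auto simp: Let_def start_vector_def intro!: add_mono divide_right_mono)

lemma weighted_nonneg: "(\<And>m. 0 \<le> w m) \<Longrightarrow> 0 \<le> weighted w ps i"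
  using weighted_mono[of "\<lambda>m. 0 * w m" w ps i] unfolding weighted_cmult by simp

lemma weighted_le_run: "(\<And>m. w m \<le> 1) \<Longrightarrow> weighted w ps i \<le> run start_vector ps i"
  using weighted_mono[of w "\<lambda>_. 1" ps i] by (simp add: weighted_one)

lemma abs_weighted_le:
  assumes "\<And>m. \<bar>w m\<bar> \<le> c"
  shows "\<bar>weighted w ps i\<bar> \<le> c * run start_vector ps i"
proof -
  have "weighted w ps i \<le> weighted (\<lambda>_. c * 1) ps i" "weighted (\<lambda>_. (- c) * 1) ps i \<le> weighted w ps i"
    using assms by (auto intro!: weighted_mono simp: abs_le_iff minus_le_iff)
  then show ?thesis unfolding weighted_cmult weighted_one by simp
qed

lemma run_start_nonneg: "0 \<le> run start_vector ps i"
  using weighted_nonneg[of "\<lambda>_. 1"] by (simp add: weighted_one)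

lemma sum_start_vector: "2 \<le> n \<Longrightarrow> (\<Sum>i=1..n. start_vector i) = 1"
  by (simp add: start_vector_def sum.delta)

text \<open>Values are nonnegative, so an averaging at most halves the value at a picked coordinate,
  and mass with count m sits where the value is at least 2^(-m). In the induction, shifting the
  weight by \<open>Suc\<close> trades one unit of \<mu> for a factor 1/2.\<close>

lemma weighted_nonzero_imp:
  assumes "\<And>m. w m \<noteq> 0 \<Longrightarrow> real m \<le> \<mu>" "weighted w ps i \<noteq> 0"
  shows "2 powr (- \<mu>) \<le> run start_vector ps i"
  using assms
proof (induction ps arbitrary: w \<mu> i)
  case Nil
  then have "i = 1" "w 0 \<noteq> 0" by (auto simp: start_vector_def split: if_splits)
  then show ?case using Nil(1)[of 0] by (simp add: start_vector_def powr_minus inverse_le_1_iff ge_one_powr_ge_zero)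
next
  case (Cons p ps)
  show ?case
  proof (cases "i = fst p \<or> i = snd p")
    case True
    then obtain j where j: "j = fst p \<or> j = snd p" "weighted (\<lambda>m. w (Suc m)) ps j \<noteq> 0"
      using Cons.prems(2) by (cases "weighted (\<lambda>m. w (Suc m)) ps (fst p) = 0") (auto simp: Let_def split: if_splits)
    have "2 powr (- (\<mu> - 1)) \<le> run start_vector ps j"
    proof (rule Cons.IH[OF _ j(2)])
      fix m assume "w (Suc m) \<noteq> 0"
      from Cons.prems(1)[OF this] show "real m \<le> \<mu> - 1" by simp
    qed
    moreover have "2 powr (- (\<mu> - 1)) = 2 * 2 powr (- \<mu>)"
      using powr_add[of 2 1 "- \<mu>"] by simp
    ultimately have "2 * 2 powr (- \<mu>) \<le> run start_vector ps (fst p) + run start_vector ps (snd p)"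
      using j(1) run_start_nonneg[of ps "fst p"] run_start_nonneg[of ps "snd p"] by (elim disjE) simp_all
    also have "\<dots> = 2 * run start_vector (p # ps) i"
      using True by (auto simp: run_Cons)
    finally show ?thesis by simp
  next
    case False
    then have "weighted w ps i \<noteq> 0" using Cons.prems(2) by (simp add: Let_def)
    from Cons.IH[OF Cons.prems(1) this] show ?thesis using False by (simp add: run_Cons)
  qed
qed

text \<open>Only the mass at the two picked coordinates has its count raised, so the total changes
  by the discrete derivative of \<open>w\<close> there.\<close>

lemma sum_weighted_Cons:
  assumes "p \<in> distinct_pairs n"
  shows "(\<Sum>i=1..n. weighted w (p # ps) i) = (\<Sum>i=1..n. weighted w ps i)
    - (weighted (\<lambda>m. w m - w (Suc m)) ps (fst p) + weighted (\<lambda>m. w m - w (Suc m)) ps (snd p))"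
  using distinct_pairsD[OF assms]
  by (subst sum_two_changes[where g = "weighted w ps" and i = "fst p" and j = "snd p"])
    (auto simp: Let_def weighted_diff)

text \<open>Every coordinate belongs to the pick with probability 2 / n, so averaging over the pick
  acts on \<open>w\<close> as one Bernoulli trial of the count.\<close>

lemma pair_mean_sum_weighted:
  assumes n: "2 \<le> n"
  shows "pair_mean n (\<lambda>p. \<Sum>i=1..n. weighted w (p # ps) i)
    = (\<Sum>i=1..n. weighted (\<lambda>m. (1 - 2 / n) * w m + 2 / n * w (Suc m)) ps i)"
proof -
  have "pair_mean n (\<lambda>p. \<Sum>i=1..n. weighted w (p # ps) i) = (\<Sum>i=1..n. weighted w ps i)
      - 2 / n * (\<Sum>i=1..n. weighted (\<lambda>m. w m - w (Suc m)) ps i)"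
    by (simp only: sum_weighted_Cons pair_mean_diff pair_mean_const[OF n] pair_mean_sum[OF n]
        cong: pair_mean_cong)
  then show ?thesis
    by (simp only: weighted_add weighted_diff weighted_cmult sum.distrib sum_subtractf
        flip: sum_distrib_left) (simp add: algebra_simps)
qed

lemma path_mean_sum_weighted_Suc:
  assumes "2 \<le> n"
  shows "path_mean n (Suc k) (\<lambda>ps. \<Sum>i=1..n. weighted w ps i)
    = path_mean n k (\<lambda>ps. \<Sum>i=1..n. weighted (\<lambda>m. (1 - 2 / n) * w m + 2 / n * w (Suc m)) ps i)"
  unfolding path_mean_Suc pair_mean_sum_weighted[OF assms] ..

text \<open>Conditioning on one Bernoulli trial. The values lie in a Banach space because both real
  weights and complex powers are inserted for \<open>f\<close>.\<close>

lemma expectation_binomial_pmf_Suc: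
  fixes f :: "nat \<Rightarrow> 'b :: {banach, second_countable_topology}"
  assumes "p \<in> {0..1}"
  shows "measure_pmf.expectation (binomial_pmf (Suc k) p) f =
    (1 - p) *\<^sub>R measure_pmf.expectation (binomial_pmf k p) f
    + p *\<^sub>R measure_pmf.expectation (binomial_pmf k p) (\<lambda>m. f (Suc m))"
proof -
  have "binomial_pmf (Suc k) p
      = bernoulli_pmf p \<bind> (\<lambda>b. map_pmf (\<lambda>m. (if b then 1 else 0) + m) (binomial_pmf k p))"
    using assms by (simp add: binomial_pmf_Suc map_pmf_def)
  then show ?thesis
    using assms finite_set_pmf_binomial_pmf[OF assms, of k]
    by (simp only:, subst pmf_expectation_bind[where A = UNIV])
      (auto simp: UNIV_bool split: if_splits)
qed

lemma expectation_binomial_pmf_0: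
  fixes f :: "nat \<Rightarrow> 'b :: {banach, second_countable_topology}"
  shows "p \<in> {0..1} \<Longrightarrow> measure_pmf.expectation (binomial_pmf 0 p) f = f 0"
  by (simp add: binomial_pmf_0)

text \<open>The count of a random piece of mass is binomial: both sides obey the same recursion. The
  weight changes along it, hence the induction over arbitrary \<open>w\<close>.\<close>

lemma path_mean_sum_weighted:
  assumes n: "2 \<le> n"
  shows "path_mean n k (\<lambda>ps. \<Sum>i=1..n. weighted w ps i)
    = measure_pmf.expectation (binomial_pmf k (2 / n)) w"
proof (induction k arbitrary: w)
  case 0
  then show ?case
    using n sum_start_vector[OF n]
    by (simp add: path_mean_0 expectation_binomial_pmf_0 flip: sum_distrib_left)
next
  case (Suc k)
  have p: "2 / real n \<in> {0..1}" using n by simp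
  show ?case
    unfolding path_mean_sum_weighted_Suc[OF n] Suc expectation_binomial_pmf_Suc[OF p]
    by (simp add: integrable_binomial_pmf[OF p])
qed

text \<open>
  A pick of \<open>(i, j)\<close> changes the total by at most the Lipschitz constant times \<open>x i + x j\<close>; the
  variance is the sum of the mean squares of these martingale increments.
\<close>

lemma variance_sum_weighted_le:
  assumes n: "2 \<le> n" and "\<And>m. \<bar>w m - w (Suc m)\<bar> \<le> c"
  shows "path_mean n k (\<lambda>ps. (\<Sum>i=1..n. weighted w ps i)\<^sup>2)
      - (path_mean n k (\<lambda>ps. \<Sum>i=1..n. weighted w ps i))\<^sup>2
    \<le> 4 * c\<^sup>2 / n * (\<Sum>t<k. path_mean n t (\<lambda>ps. \<Sum>i=1..n. (run start_vector ps i)\<^sup>2))"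
  using assms(2)
proof (induction k arbitrary: w)
  case 0
  then show ?case by (simp add: path_mean_0)
next
  case (Suc k)
  \<comment> \<open>\<open>?w\<close> is the weight seen one pick earlier: its total is the
    conditional mean of the total for \<open>w\<close>. As a convex combination of \<open>w\<close>
    and its shift it keeps the Lipschitz constant.\<close>
  let ?w = "\<lambda>m. (1 - 2 / n) * w m + 2 / n * w (Suc m)"
  let ?N = "\<lambda>ps. \<Sum>i=1..n. (run start_vector ps i)\<^sup>2"
  have w: "\<bar>?w m - ?w (Suc m)\<bar> \<le> c" for m
  proof -
    have "\<bar>?w m - ?w (Suc m)\<bar> = \<bar>(1 - 2 / n) * (w m - w (Suc m)) + 2 / n * (w (Suc m) - w (Suc (Suc m)))\<bar>"
      by (rule arg_cong[where f = abs]) (simp add: divide_inverse algebra_simps)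
    also have "\<dots> \<le> (1 - 2 / n) * \<bar>w m - w (Suc m)\<bar> + 2 / n * \<bar>w (Suc m) - w (Suc (Suc m))\<bar>"
      using n by (intro order_trans[OF abs_triangle_ineq]) (simp add: abs_mult del: times_divide_eq_left)
    also have "\<dots> \<le> (1 - 2 / n) * c + 2 / n * c"
      using n Suc.prems by (intro add_mono mult_left_mono) auto
    finally show ?thesis by (simp add: algebra_simps)
  qed
  have "path_mean n (Suc k) (\<lambda>ps. (\<Sum>i=1..n. weighted w ps i)\<^sup>2)
      \<le> path_mean n k (\<lambda>ps. (\<Sum>i=1..n. weighted ?w ps i)\<^sup>2 + 4 * c\<^sup>2 / n * ?N ps)"
    unfolding path_mean_Suc
  proof (rule path_mean_mono)
    fix ps
    define v where "v = weighted (\<lambda>m. w m - w (Suc m)) ps"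
    let ?S = "\<Sum>i=1..n. weighted w ps i"
    have eq: "pair_mean n (\<lambda>p. (\<Sum>i=1..n. weighted w (p # ps) i)\<^sup>2)
        = pair_mean n (\<lambda>p. (?S - (v (fst p) + v (snd p)))\<^sup>2)"
      unfolding v_def by (simp only: sum_weighted_Cons cong: pair_mean_cong)
    have "?S - pair_mean n (\<lambda>p. v (fst p) + v (snd p)) = pair_mean n (\<lambda>p. \<Sum>i=1..n. weighted w (p # ps) i)"
      unfolding v_def by (simp only: sum_weighted_Cons pair_mean_diff pair_mean_const[OF n] cong: pair_mean_cong)
    also have "\<dots> = (\<Sum>i=1..n. weighted ?w ps i)"
      by (rule pair_mean_sum_weighted[OF n])
    finally have mean: "?S - pair_mean n (\<lambda>p. v (fst p) + v (snd p)) = (\<Sum>i=1..n. weighted ?w ps i)" .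
    \<comment> \<open>The inequality (a + b)^2 <= 2 (a^2 + b^2), together with the 2 / n of
      \<open>pair_mean_sum\<close>, yields the factor 4 / n.\<close>
    have "pair_mean n (\<lambda>p. (v (fst p) + v (snd p))\<^sup>2) \<le> pair_mean n (\<lambda>p. 2 * ((v (fst p))\<^sup>2 + (v (snd p))\<^sup>2))"
      by (intro pair_mean_mono) (smt (verit) sum_squares_bound power2_sum)
    also have "\<dots> = 4 / n * (\<Sum>i=1..n. (v i)\<^sup>2)"
      using pair_mean_sum[OF n, of "\<lambda>i. (v i)\<^sup>2"] by (simp only: pair_mean_cmult)
    also have "\<dots> \<le> 4 / n * (\<Sum>i=1..n. (c * run start_vector ps i)\<^sup>2)"
    proof (intro mult_left_mono sum_mono)
      fix i
      show "(v i)\<^sup>2 \<le> (c * run start_vector ps i)\<^sup>2"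
        using power_mono[OF abs_weighted_le[of "\<lambda>m. w m - w (Suc m)" c ps i, OF Suc.prems] abs_ge_zero, of 2]
        by (simp add: v_def)
    qed simp
    also have "\<dots> = 4 * c\<^sup>2 / n * ?N ps"
      by (simp add: power_mult_distrib flip: sum_distrib_left)
    finally show "pair_mean n (\<lambda>p. (\<Sum>i=1..n. weighted w (p # ps) i)\<^sup>2)
        \<le> (\<Sum>i=1..n. weighted ?w ps i)\<^sup>2 + 4 * c\<^sup>2 / n * ?N ps"
      using pair_mean_shift_square_le[OF n, of ?S "\<lambda>p. v (fst p) + v (snd p)"] unfolding eq mean by linarith
  qed
  also have "\<dots> = path_mean n k (\<lambda>ps. (\<Sum>i=1..n. weighted ?w ps i)\<^sup>2) + 4 * c\<^sup>2 / n * path_mean n k ?N"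
    by (simp only: path_mean_add path_mean_cmult)
  finally show ?case
    using Suc.IH[of ?w, OF w] unfolding path_mean_sum_weighted_Suc[OF n, of k w]
    by (simp add: algebra_simps)
qed

text \<open>Subtracting 1 / n from every coordinate leaves a zero-sum vector of squared norm 1 - 1 /
  n, which decays exactly; the constant part is invariant and contributes 1 / n.\<close>

lemma path_mean_sum_sq_run_start:
  assumes n: "2 \<le> n"
  shows "path_mean n t (\<lambda>ps. \<Sum>i=1..n. (run start_vector ps i)\<^sup>2)
    = 1 / n + (1 - 1 / (real n - 1)) ^ t * (1 - 1 / n)"
proof -
  let ?u = "\<lambda>i. start_vector i + - (1 / n)"
  have u: "(\<Sum>i=1..n. ?u i) = 0"
    using n sum_start_vector[OF n] by (simp add: sum_subtractf)
  have sq: "(\<Sum>i=1..n. (x i + - (1 / n))\<^sup>2) = (\<Sum>i=1..n. (x i)\<^sup>2) - 1 / n"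
    if "(\<Sum>i=1..n. x i) = 1" for x :: "nat \<Rightarrow> real"
  proof -
    have "(\<Sum>i=1..n. (x i + - (1 / n))\<^sup>2) = (\<Sum>i=1..n. (x i)\<^sup>2 - 2 / n * x i + (1 / n)\<^sup>2)"
      by (intro sum.cong refl) (simp add: power2_eq_square field_simps)
    also have "\<dots> = (\<Sum>i=1..n. (x i)\<^sup>2) - 2 / n * (\<Sum>i=1..n. x i) + n * (1 / n)\<^sup>2"
      by (simp only: sum.distrib sum_subtractf flip: sum_distrib_left) simp
    finally show ?thesis using n that by (simp add: power2_eq_square field_simps)
  qed
  have start: "(\<Sum>i=1..n. (start_vector i)\<^sup>2) = 1"
    unfolding sum_start_vector[OF n, symmetric] by (intro sum.cong) (auto simp: start_vector_def)
  have "path_mean n t (\<lambda>ps. (\<Sum>i=1..n. (run start_vector ps i)\<^sup>2) - 1 / n)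
      = path_mean n t (\<lambda>ps. \<Sum>i=1..n. (run ?u ps i)\<^sup>2)"
  proof (rule path_mean_cong)
    fix ps assume "set ps \<subseteq> distinct_pairs n"
    then have "(\<Sum>i=1..n. run start_vector ps i) = 1"
      using sum_run[of ps n start_vector] sum_start_vector[OF n] by simp
    from sq[OF this] show "(\<Sum>i=1..n. (run start_vector ps i)\<^sup>2) - 1 / n = (\<Sum>i=1..n. (run ?u ps i)\<^sup>2)"
      unfolding run_add run_const by simp
  qed
  also have "\<dots> = (1 - 1 / (real n - 1)) ^ t * (1 - 1 / n)"
    unfolding path_mean_sum_sq_run[OF n u] sq[OF sum_start_vector[OF n]] start ..
  finally show ?thesis unfolding path_mean_diff path_mean_const[OF n] by linarith
qed

text \<open>The geometric series with ratio 1 - 1 / (n - 1) sums to at most n - 1. For k of order n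
  log n the whole bound is O(n), which makes the variance in \<open>variance_sum_weighted_le\<close>
  O(c^2).\<close>

lemma sum_path_mean_sum_sq_run_start_le:
  assumes n: "2 \<le> n"
  shows "(\<Sum>t<k. path_mean n t (\<lambda>ps. \<Sum>i=1..n. (run start_vector ps i)\<^sup>2)) \<le> real k / n + n"
proof -
  let ?q = "1 - 1 / (real n - 1)"
  have "(\<Sum>t<k. ?q ^ t) * (1 - ?q) = 1 - ?q ^ k"
    using one_diff_power_eq[of ?q k] by (simp add: mult.commute)
  also have "\<dots> \<le> 1" using n by simp
  finally have "(\<Sum>t<k. ?q ^ t) \<le> real n - 1" using n by (simp add: field_simps)
  then have "(\<Sum>t<k. ?q ^ t) * (1 - 1 / n) \<le> (real n - 1) * 1"
    using n by (intro mult_mono) (auto intro!: sum_nonneg)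
  then show ?thesis
    unfolding path_mean_sum_sq_run_start[OF n] by (simp add: sum.distrib flip: sum_distrib_right)
qed

text \<open>
  The left-hand side is the mean of \<open>w m\<close> times the value at the coordinate of a random piece of mass.
  Its own value halves at each averaging, and its random partner adds a value of mean at most
  \<open>1 / (n - 1)\<close>.
\<close>

lemma path_mean_sum_run_mult_weighted_le:
  assumes n: "2 \<le> n" and "\<And>m. 0 \<le> w m"
  shows "path_mean n k (\<lambda>ps. \<Sum>i=1..n. run start_vector ps i * weighted w ps i)
    \<le> measure_pmf.expectation (binomial_pmf k (2 / n)) (\<lambda>m. w m * (1 / 2 ^ m + 1 / (real n - 1)))"
  using assms(2)
proof (induction k arbitrary: w)
  case 0
  have "(\<Sum>i=1..n. start_vector i * (w 0 * start_vector i)) = w 0 * (\<Sum>i=1..n. start_vector i)"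
    unfolding sum_distrib_left by (intro sum.cong) (auto simp: start_vector_def)
  then show ?case
    using n 0[of 0] sum_start_vector[OF n]
    by (simp add: path_mean_0 expectation_binomial_pmf_0 algebra_simps)
next
  case (Suc k)
  have p: "2 / real n \<in> {0..1}" using n by simp
  let ?w = "\<lambda>m. w (Suc m)" and ?c = "1 / (real n - 1)"
  let ?Q = "\<lambda>w ps. \<Sum>i=1..n. run start_vector ps i * weighted w ps i"
  let ?B = "measure_pmf.expectation (binomial_pmf k (2 / n))"
  have lin: "pair_mean n (\<lambda>p. a - F p + b * G p + c * H p)
      = a - pair_mean n F + b * pair_mean n G + c * pair_mean n H" for a b c F G H
    by (simp only: pair_mean_add pair_mean_diff pair_mean_cmult pair_mean_const[OF n])
  have scal: "A - 2 / N * A + 1/2 * (2 / N * B) + 1/2 * (2 / (N * (N - 1)) * (1 * S - B))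
      = (1 - 2 / N) * A + 1 / N * B + 1 / (N - 1) / N * S - B / (N * (N - 1))" for A B S N :: real
  proof -
    define r where "r = inverse (N * (N - 1))"
    have "1 / (N - 1) / N = r" by (simp only: r_def inverse_mult_distrib divide_inverse mult_1 mult.commute)
    then show ?thesis
      unfolding divide_inverse[of _ "N * (N - 1)"] r_def[symmetric]
      by (simp add: left_diff_distrib right_diff_distrib)
  qed
  \<comment> \<open>At the two picked coordinates the products of averages expand into own terms and
    cross terms, each with factor 1/2. The cross terms give the \<open>?c / n\<close> term after a
    nonnegative diagonal correction is dropped.\<close>
  have *: "pair_mean n (\<lambda>p. ?Q w (p # ps))
      \<le> (1 - 2 / n) * ?Q w ps + 1 / n * ?Q ?w ps + ?c / n * (\<Sum>i=1..n. weighted ?w ps i)"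
    if ps: "set ps \<subseteq> distinct_pairs n" for ps
  proof -
    let ?x = "run start_vector ps"
    have x: "(\<Sum>i=1..n. ?x i) = 1"
      using sum_run[OF ps, of start_vector] sum_start_vector[OF n] by simp
    have "pair_mean n (\<lambda>p. ?Q w (p # ps)) = pair_mean n (\<lambda>p. ?Q w ps
        - (?x (fst p) * weighted w ps (fst p) + ?x (snd p) * weighted w ps (snd p))
        + 1/2 * (?x (fst p) * weighted ?w ps (fst p) + ?x (snd p) * weighted ?w ps (snd p))
        + 1/2 * (?x (fst p) * weighted ?w ps (snd p) + weighted ?w ps (fst p) * ?x (snd p)))"
    proof (rule pair_mean_cong)
      fix p assume p: "p \<in> distinct_pairs n"
      show "?Q w (p # ps) = ?Q w ps
        - (?x (fst p) * weighted w ps (fst p) + ?x (snd p) * weighted w ps (snd p))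
        + 1/2 * (?x (fst p) * weighted ?w ps (fst p) + ?x (snd p) * weighted ?w ps (snd p))
        + 1/2 * (?x (fst p) * weighted ?w ps (snd p) + weighted ?w ps (fst p) * ?x (snd p))"
        using distinct_pairsD[OF p]
        by (subst sum_two_changes[where g = "\<lambda>i. ?x i * weighted w ps i" and i = "fst p" and j = "snd p"])
          (auto simp: run_Cons Let_def algebra_simps add_divide_distrib)
    qed
    also have "\<dots> = ?Q w ps - 2 / n * ?Q w ps + 1/2 * (2 / n * ?Q ?w ps)
        + 1/2 * (2 / (real n * (real n - 1)) * (1 * (\<Sum>i=1..n. weighted ?w ps i) - ?Q ?w ps))"
      unfolding lin pair_mean_sum[OF n, of "\<lambda>i. ?x i * weighted w ps i"]
        pair_mean_sum[OF n, of "\<lambda>i. ?x i * weighted ?w ps i"]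
        pair_mean_cross[OF n, of ?x "weighted ?w ps"] x ..
    also have "\<dots> = (1 - 2 / n) * ?Q w ps + 1 / n * ?Q ?w ps + ?c / n * (\<Sum>i=1..n. weighted ?w ps i)
        - ?Q ?w ps / (real n * (real n - 1))"
      by (rule scal)
    finally have eq: "pair_mean n (\<lambda>p. ?Q w (p # ps)) = (1 - 2 / n) * ?Q w ps + 1 / n * ?Q ?w ps
        + ?c / n * (\<Sum>i=1..n. weighted ?w ps i) - ?Q ?w ps / (real n * (real n - 1))" .
    have "0 \<le> ?Q ?w ps / (real n * (real n - 1))"
      using n Suc.prems by (intro divide_nonneg_nonneg sum_nonneg mult_nonneg_nonneg run_start_nonneg weighted_nonneg) auto
    then show ?thesis unfolding eq by simp
  qed
  \<comment> \<open>The factor 1 / N recovers only half of \<open>c\<close> in the bound; the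
    partner's contribution \<open>c / N\<close> restores the other half, so the bound reproduces
    itself with the exponent raised by one.\<close>
  have scal': "1 / N * (W * (1 / 2 ^ m + c)) + c / N * W = 2 / N * (W * (1 / 2 ^ Suc m + c))"
    for N W c :: real and m
    by (simp add: distrib_left add_divide_distrib mult.commute)
  have "path_mean n (Suc k) (?Q w)
      \<le> path_mean n k (\<lambda>ps. (1 - 2 / n) * ?Q w ps + 1 / n * ?Q ?w ps + ?c / n * (\<Sum>i=1..n. weighted ?w ps i))"
    unfolding path_mean_Suc by (rule path_mean_mono) (rule *)
  also have "\<dots> = (1 - 2 / n) * path_mean n k (?Q w) + 1 / n * path_mean n k (?Q ?w) + ?c / n * ?B ?w"
    by (simp only: path_mean_add path_mean_cmult path_mean_sum_weighted[OF n])
  also have "\<dots> \<le> (1 - 2 / n) * ?B (\<lambda>m. w m * (1 / 2 ^ m + ?c))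
      + 1 / n * ?B (\<lambda>m. ?w m * (1 / 2 ^ m + ?c)) + ?c / n * ?B ?w"
    using n Suc.prems by (intro add_mono mult_left_mono Suc.IH order_refl) auto
  finally have le: "path_mean n (Suc k) (?Q w) \<le> (1 - 2 / n) * ?B (\<lambda>m. w m * (1 / 2 ^ m + ?c))
      + 1 / n * ?B (\<lambda>m. ?w m * (1 / 2 ^ m + ?c)) + ?c / n * ?B ?w" .
  have "1 / n * ?B (\<lambda>m. ?w m * (1 / 2 ^ m + ?c)) + ?c / n * ?B ?w
      = ?B (\<lambda>m. 1 / n * (?w m * (1 / 2 ^ m + ?c)) + ?c / n * ?w m)"
    by (simp add: integrable_binomial_pmf[OF p])
  also have "(\<lambda>m. 1 / n * (?w m * (1 / 2 ^ m + ?c)) + ?c / n * ?w m)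
      = (\<lambda>m. 2 / n * (?w m * (1 / 2 ^ Suc m + ?c)))"
    by (rule ext) (rule scal')
  also have "?B (\<lambda>m. 2 / n * (?w m * (1 / 2 ^ Suc m + ?c))) = 2 / n * ?B (\<lambda>m. ?w m * (1 / 2 ^ Suc m + ?c))"
    by (rule integral_mult_right_zero)
  finally show ?case
    using le unfolding expectation_binomial_pmf_Suc[OF p] by simp
qed

section \<open>Central limit theorem for the binomial count, by way of the Poisson characteristic
  function\<close>

section \<open>Normal approximation of the number of halvings\<close>

text \<open>The probability generating function; at \<open>iexp s\<close> it is the characteristic
  function of the binomial law.\<close>

lemma expectation_binomial_pmf_power:
  fixes z :: complex
  assumes "p \<in> {0..1}"
  shows "measure_pmf.expectation (binomial_pmf k p) (\<lambda>m. z ^ m) = (1 - of_real p + of_real p * z) ^ k"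
proof (induction k)
  case 0
  then show ?case using assms by (simp add: expectation_binomial_pmf_0)
next
  case (Suc k)
  have "measure_pmf.expectation (binomial_pmf (Suc k) p) (\<lambda>m. z ^ m) =
      (1 - p) *\<^sub>R (1 - of_real p + of_real p * z) ^ k + p *\<^sub>R (z * (1 - of_real p + of_real p * z) ^ k)"
    unfolding expectation_binomial_pmf_Suc[OF assms] by (simp add: Suc)
  then show ?case by (simp add: scaleR_conv_of_real algebra_simps)
qed

lemma cmod_iexp_minus_one_le: "cmod (iexp s - 1) \<le> \<bar>s\<bar>"
  using iexp_approx1[of s 0] by simp

text \<open>With u = p (iexp s - 1) both 1 + u and exp u have modulus at most 1, so their k-th
  powers differ by at most k times |1 + u - exp u|. Taylor bounds this by a multiple of |u|^2; the
  multiple is exp 2 because |Re u| <= 2.\<close>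

lemma binomial_minus_poisson_char_le:
  assumes p: "p \<in> {0..1}"
  shows "cmod ((1 - of_real p + of_real p * iexp s) ^ k - exp (of_real (real k * p) * (iexp s - 1)))
    \<le> real k * (exp 2 * (p * s)\<^sup>2)"
proof -
  define u where "u = of_real p * (iexp s - 1)"
  have Re: "Re u = - (p * (1 - cos s))" by (simp add: u_def Re_exp algebra_simps)
  have Re2: "p * (1 - cos s) \<le> 1 * 2" using p cos_ge_minus_one[of s] cos_le_one[of s] by (intro mult_mono) auto
  have Re3: "0 \<le> p * (1 - cos s)" using p by simp
  have "1 + u = of_real (1 - p) + of_real p * iexp s" by (simp add: u_def right_diff_distrib)
  also have "cmod \<dots> \<le> cmod (of_real (1 - p)) + cmod (of_real p * iexp s)" by (rule norm_triangle_ineq)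
  also have "\<dots> = 1" using p unfolding norm_mult norm_of_real norm_exp_i_times by simp
  finally have 1: "cmod (1 + u) \<le> 1" .
  have 2: "cmod (exp u) \<le> 1" using Re Re3 by simp
  have "cmod u \<le> p * \<bar>s\<bar>"
    unfolding u_def norm_mult using p cmod_iexp_minus_one_le[of s] by (simp add: mult_left_mono)
  then have u2: "(cmod u)\<^sup>2 \<le> (p * s)\<^sup>2"
    using power_mono[of "cmod u" "p * \<bar>s\<bar>" 2] by (simp add: power_mult_distrib)
  have "cmod (exp u - (\<Sum>i\<le>1. u ^ i / fact i)) \<le> exp \<bar>Re u\<bar> * cmod u ^ Suc 1 / fact 1"
    by (rule Taylor_exp)
  then have "cmod (exp u - (1 + u)) \<le> exp \<bar>Re u\<bar> * (cmod u)\<^sup>2" by (simp add: power2_eq_square)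
  also have "\<dots> \<le> exp 2 * (p * s)\<^sup>2"
    using Re Re2 Re3 u2 by (intro mult_mono) auto
  finally have 3: "cmod ((1 + u) - exp u) \<le> exp 2 * (p * s)\<^sup>2" by (simp add: norm_minus_commute)
  have "cmod ((1 + u) ^ k - exp u ^ k) \<le> real k * cmod ((1 + u) - exp u)"
    by (rule norm_power_diff[OF 1 2])
  also have "\<dots> \<le> real k * (exp 2 * (p * s)\<^sup>2)" by (intro mult_left_mono 3) simp
  also have "exp u ^ k = exp (of_real (real k * p) * (iexp s - 1))"
    by (simp add: u_def mult.assoc flip: exp_of_nat_mult)
  also have "1 + u = 1 - of_real p + of_real p * iexp s" by (simp add: u_def algebra_simps)
  finally show ?thesis .
qed

text \<open>Levy continuity. As p tends to 0, the characteristic function may be replaced by the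
  Poisson one, whose exponent is expanded to second order: \<open>a\<close> is the limiting drift,
  and the quadratic term gives -t^2 / 2.\<close>

lemma binomial_weak_conv:
  fixes k :: "nat \<Rightarrow> nat" and p \<sigma> :: "nat \<Rightarrow> real" and a :: real
  assumes p: "\<forall>\<^sub>F n in sequentially. p n \<in> {0..1}" "p \<longlonglongrightarrow> 0"
    and \<sigma>: "filterlim \<sigma> at_top sequentially"
    and a: "(\<lambda>n. (real (k n) * p n - (\<sigma> n)\<^sup>2) / \<sigma> n) \<longlonglongrightarrow> a"
  shows "weak_conv_m
    (\<lambda>n. distr (measure_pmf (binomial_pmf (k n) (p n))) borel (\<lambda>m. (real m - (\<sigma> n)\<^sup>2) / \<sigma> n - a))
    std_normal_distribution"
proof (rule levy_continuity)
  show "real_distribution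
      (distr (measure_pmf (binomial_pmf (k n) (p n))) borel (\<lambda>m. (real m - (\<sigma> n)\<^sup>2) / \<sigma> n - a))" for n
    by (intro prob_space.real_distribution_distr[OF prob_space_measure_pmf]) auto
  show "real_distribution std_normal_distribution"
    by (rule real_dist_normal_dist)
  fix t :: real
  define l where "l n = real (k n) * p n" for n
  define s where "s n = t / \<sigma> n" for n
  let ?\<phi> = "\<lambda>n. char (distr (measure_pmf (binomial_pmf (k n) (p n))) borel
      (\<lambda>m. (real m - (\<sigma> n)\<^sup>2) / \<sigma> n - a)) t"
  have pos: "\<forall>\<^sub>F n in sequentially. 0 < \<sigma> n"
    using \<sigma> by (simp add: filterlim_at_top_dense)
  have inv: "(\<lambda>n. 1 / \<sigma> n) \<longlonglongrightarrow> 0"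
    using \<sigma> by (intro tendsto_divide_0[OF tendsto_const]) (rule filterlim_at_top_imp_at_infinity)
  \<comment> \<open>The binomial mean \<open>l n\<close> differs from \<sigma>^2 by O(\<sigma>), so
    the two are asymptotically equal.\<close>
  have "(\<lambda>n. 1 + (l n - (\<sigma> n)\<^sup>2) / \<sigma> n * (1 / \<sigma> n)) \<longlonglongrightarrow> 1 + a * 0"
    using a inv unfolding l_def by (intro tendsto_intros)
  then have "(\<lambda>n. l n / (\<sigma> n)\<^sup>2) \<longlonglongrightarrow> 1 + a * 0"
  proof (rule Lim_transform_eventually)
    show "\<forall>\<^sub>F n in sequentially. 1 + (l n - (\<sigma> n)\<^sup>2) / \<sigma> n * (1 / \<sigma> n) = l n / (\<sigma> n)\<^sup>2"
      using pos by eventually_elim (simp add: field_simps power2_eq_square)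
  qed
  then have ratio: "(\<lambda>n. l n / (\<sigma> n)\<^sup>2) \<longlonglongrightarrow> 1" by simp
  have char: "\<forall>\<^sub>F n in sequentially.
      iexp (- (t * \<sigma> n + t * a)) * (1 - of_real (p n) + of_real (p n) * iexp (s n)) ^ k n = ?\<phi> n"
    using p(1) pos
  proof eventually_elim
    case (elim n)
    have "?\<phi> n = measure_pmf.expectation (binomial_pmf (k n) (p n))
        (\<lambda>m. iexp (t * ((real m - (\<sigma> n)\<^sup>2) / \<sigma> n - a)))"
      unfolding char_def by (subst integral_distr) auto
    also have "(\<lambda>m. iexp (t * ((real m - (\<sigma> n)\<^sup>2) / \<sigma> n - a)))
        = (\<lambda>m. iexp (- (t * \<sigma> n + t * a)) * iexp (s n) ^ m)"
    proof
      fix m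
      have "t * ((real m - (\<sigma> n)\<^sup>2) / \<sigma> n - a) = - (t * \<sigma> n + t * a) + real m * s n"
        using elim by (simp add: s_def field_simps power2_eq_square)
      then have "iexp (t * ((real m - (\<sigma> n)\<^sup>2) / \<sigma> n - a)) = iexp (- (t * \<sigma> n + t * a)) * iexp (real m * s n)"
        by (simp only: of_real_add distrib_left exp_add)
      also have "iexp (real m * s n) = iexp (s n) ^ m"
        by (simp add: exp_of_nat_mult[symmetric] algebra_simps)
      finally show "iexp (t * ((real m - (\<sigma> n)\<^sup>2) / \<sigma> n - a)) = iexp (- (t * \<sigma> n + t * a)) * iexp (s n) ^ m" .
    qed
    finally show ?case
      using expectation_binomial_pmf_power[OF elim(1), of "k n" "iexp (s n)"] by simp
  qed
  \<comment> \<open>\<open>e n\<close> is the cubic remainder of the Poisson exponent. Its size l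
    |s|^3 / 6 is O(1 / \<sigma>), since l is asymptotic to \<sigma>^2 and s = t / \<sigma>.\<close>
  define e where "e n = of_real (l n) * (iexp (s n) - 1 - \<i> * of_real (s n) + of_real ((s n)\<^sup>2 / 2))" for n
  have e: "e \<longlonglongrightarrow> 0"
  proof (rule Lim_null_comparison)
    show "\<forall>\<^sub>F n in sequentially. norm (e n) \<le> l n / (\<sigma> n)\<^sup>2 * (\<bar>t\<bar> ^ 3 / 6) * (1 / \<sigma> n)"
      using p(1) pos
    proof eventually_elim
      case (elim n)
      have "cmod (iexp (s n) - (\<Sum>i\<le>2. (\<i> * of_real (s n)) ^ i / fact i)) \<le> \<bar>s n\<bar> ^ 3 / 6"
        using iexp_approx1[of "s n" 2] by (simp add: fact_numeral numeral_3_eq_3)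
      also have "(\<Sum>i\<le>2. (\<i> * of_real (s n)) ^ i / fact i) = 1 + \<i> * of_real (s n) - of_real ((s n)\<^sup>2 / 2)"
        by (simp add: numeral_2_eq_2 power2_eq_square mult_ac)
      finally have "cmod (iexp (s n) - 1 - \<i> * of_real (s n) + of_real ((s n)\<^sup>2 / 2)) \<le> \<bar>s n\<bar> ^ 3 / 6"
        by (simp add: algebra_simps)
      moreover have l0: "0 \<le> l n" using elim by (simp add: l_def)
      ultimately have "norm (e n) \<le> l n * (\<bar>s n\<bar> ^ 3 / 6)"
        unfolding e_def norm_mult norm_of_real abs_of_nonneg[OF l0] by (intro mult_left_mono)
      also have "\<dots> = l n / (\<sigma> n)\<^sup>2 * (\<bar>t\<bar> ^ 3 / 6) * (1 / \<sigma> n)"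
        using elim by (simp add: s_def abs_divide power_divide power2_eq_square power3_eq_cube)
      finally show ?case .
    qed
    show "(\<lambda>n. l n / (\<sigma> n)\<^sup>2 * (\<bar>t\<bar> ^ 3 / 6) * (1 / \<sigma> n)) \<longlonglongrightarrow> 0"
      using tendsto_mult[OF tendsto_mult[OF ratio tendsto_const] inv, of "\<bar>t\<bar> ^ 3 / 6"]
      by (simp only: mult_zero_right)
  qed
  \<comment> \<open>The three terms are the remainder, the drift minus its limit, and the Gaussian
    exponent.\<close>
  have "(\<lambda>n. e n + \<i> * of_real (t * ((l n - (\<sigma> n)\<^sup>2) / \<sigma> n) - t * a) - of_real (l n / (\<sigma> n)\<^sup>2 * (t\<^sup>2 / 2)))
      \<longlonglongrightarrow> 0 + \<i> * of_real (t * a - t * a) - of_real (1 * (t\<^sup>2 / 2))"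
    using e a ratio unfolding l_def by (intro tendsto_intros)
  then have "(\<lambda>n. exp (e n + \<i> * of_real (t * ((l n - (\<sigma> n)\<^sup>2) / \<sigma> n) - t * a)
      - of_real (l n / (\<sigma> n)\<^sup>2 * (t\<^sup>2 / 2)))) \<longlonglongrightarrow> exp (0 + \<i> * of_real (t * a - t * a) - of_real (1 * (t\<^sup>2 / 2)))"
    by (intro tendsto_exp)
  then have "(\<lambda>n. iexp (- (t * \<sigma> n + t * a)) * exp (of_real (l n) * (iexp (s n) - 1)))
      \<longlonglongrightarrow> exp (0 + \<i> * of_real (t * a - t * a) - of_real (1 * (t\<^sup>2 / 2)))"
  proof (rule Lim_transform_eventually)
    show "\<forall>\<^sub>F n in sequentially. exp (e n + \<i> * of_real (t * ((l n - (\<sigma> n)\<^sup>2) / \<sigma> n) - t * a)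
        - of_real (l n / (\<sigma> n)\<^sup>2 * (t\<^sup>2 / 2)))
      = iexp (- (t * \<sigma> n + t * a)) * exp (of_real (l n) * (iexp (s n) - 1))"
      using pos
    proof eventually_elim
      case (elim n)
      have s1: "t * ((l n - (\<sigma> n)\<^sup>2) / \<sigma> n) - t * a = l n * s n - (t * \<sigma> n + t * a)"
        using elim by (simp add: s_def field_simps power2_eq_square)
      have s2: "l n / (\<sigma> n)\<^sup>2 * (t\<^sup>2 / 2) = l n * ((s n)\<^sup>2 / 2)"
        by (simp add: s_def power_divide)
      have "e n + \<i> * of_real (t * ((l n - (\<sigma> n)\<^sup>2) / \<sigma> n) - t * a) - of_real (l n / (\<sigma> n)\<^sup>2 * (t\<^sup>2 / 2))
          = \<i> * of_real (- (t * \<sigma> n + t * a)) + of_real (l n) * (iexp (s n) - 1)"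
        unfolding s1 s2 e_def of_real_diff of_real_mult of_real_minus
        by (simp add: ring_distribs mult.left_commute)
      then show ?case by (simp only: exp_add)
    qed
  qed
  \<comment> \<open>Passing from binomial to Poisson costs a constant times k (p s)^2 = (l /
    \<sigma>^2) p t^2, which vanishes with p.\<close>
  moreover have "(\<lambda>n. iexp (- (t * \<sigma> n + t * a)) * (1 - of_real (p n) + of_real (p n) * iexp (s n)) ^ k n
      - iexp (- (t * \<sigma> n + t * a)) * exp (of_real (l n) * (iexp (s n) - 1))) \<longlonglongrightarrow> 0"
  proof (rule Lim_null_comparison)
    show "\<forall>\<^sub>F n in sequentially. norm (iexp (- (t * \<sigma> n + t * a)) * (1 - of_real (p n) + of_real (p n) * iexp (s n)) ^ k n
      - iexp (- (t * \<sigma> n + t * a)) * exp (of_real (l n) * (iexp (s n) - 1)))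
      \<le> l n / (\<sigma> n)\<^sup>2 * p n * (exp 2 * t\<^sup>2)"
      using p(1)
    proof eventually_elim
      case (elim n)
      have "norm (iexp (- (t * \<sigma> n + t * a)) * (1 - of_real (p n) + of_real (p n) * iexp (s n)) ^ k n
          - iexp (- (t * \<sigma> n + t * a)) * exp (of_real (l n) * (iexp (s n) - 1)))
        = cmod ((1 - of_real (p n) + of_real (p n) * iexp (s n)) ^ k n - exp (of_real (l n) * (iexp (s n) - 1)))"
        unfolding right_diff_distrib[symmetric] norm_mult norm_exp_i_times by simp
      also have "\<dots> \<le> real (k n) * (exp 2 * (p n * s n)\<^sup>2)"
        unfolding l_def by (rule binomial_minus_poisson_char_le[OF elim])
      also have "\<dots> = l n / (\<sigma> n)\<^sup>2 * p n * (exp 2 * t\<^sup>2)"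
        by (simp add: l_def s_def power_divide power2_eq_square)
      finally show ?case .
    qed
    show "(\<lambda>n. l n / (\<sigma> n)\<^sup>2 * p n * (exp 2 * t\<^sup>2)) \<longlonglongrightarrow> 0"
      using tendsto_mult[OF tendsto_mult[OF ratio p(2)] tendsto_const, of "exp 2 * t\<^sup>2"]
      by (simp only: mult_zero_right mult_zero_left)
  qed
  ultimately have "(\<lambda>n. iexp (- (t * \<sigma> n + t * a)) * (1 - of_real (p n) + of_real (p n) * iexp (s n)) ^ k n)
      \<longlonglongrightarrow> exp (0 + \<i> * of_real (t * a - t * a) - of_real (1 * (t\<^sup>2 / 2)))"
    by (rule Lim_transform)
  from Lim_transform_eventually[OF this char]
  show "?\<phi> \<longlonglongrightarrow> char std_normal_distribution t"
    by (simp add: char_std_normal_distribution exp_of_real[symmetric])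
qed

lemma isCont_cdf_std_normal: "isCont (cdf std_normal_distribution) x"
proof -
  interpret real_distribution std_normal_distribution by (rule real_dist_normal_dist)
  have "emeasure std_normal_distribution {x} = 0"
    by (subst emeasure_density) (auto simp: nn_integral_null_set)
  then show ?thesis by (simp add: isCont_cdf measure_def)
qed

lemma filterlim_sqrt_log2: "filterlim (\<lambda>n::nat. sqrt (log 2 (real n))) at_top sequentially"
  by real_asymp

lemma averaging_time_approx:
  "\<forall>\<^sub>F n in sequentially.
     \<bar>real (averaging_time b n) - real n * (log 2 (real n) + b * sqrt (log 2 (real n))) / 2\<bar> \<le> 1"
proof -
  have "\<forall>\<^sub>F n in sequentially. 0 \<le> real n * (log 2 (real n) + b * sqrt (log 2 (real n))) / 2"
    by real_asymp
  then show ?thesis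
  proof eventually_elim
    case (elim n)
    then have "real (averaging_time b n) = of_int \<lfloor>real n * (log 2 (real n) + b * sqrt (log 2 (real n))) / 2\<rfloor>"
      unfolding averaging_time_def by simp
    then show ?case by linarith
  qed
qed

text \<open>At \<open>averaging_time b n\<close> the count has mean log2 n + b sqrt(log2 n) up to
  O(1 / n) and variance asymptotic to log2 n. The drift is therefore b, and the threshold u becomes
  u - b.\<close>

lemma binomial_averaging_time_tendsto:
  "(\<lambda>n. measure_pmf.prob (binomial_pmf (averaging_time b n) (2 / n))
      {m. real m \<le> log 2 (real n) + u * sqrt (log 2 (real n))}) \<longlonglongrightarrow> cdf std_normal_distribution (u - b)"
proof -
  let ?\<sigma> = "\<lambda>n::nat. sqrt (log 2 (real n))"
  have pos: "\<forall>\<^sub>F n in sequentially. 0 < ?\<sigma> n \<and> 2 \<le> n"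
    by (intro eventually_conj filterlim_sqrt_log2[unfolded filterlim_at_top_dense, rule_format] eventually_ge_at_top)
  have scal: "(K * (2 / N) - x\<^sup>2) / x - b = (K - N * (x\<^sup>2 + b * x) / 2) * (2 / N) / x"
    if "0 < x" "0 < N" for K N x :: real
    using that by (simp add: field_simps power2_eq_square)
  \<comment> \<open>Rounding the time by at most one pick moves the binomial mean by at most 2 /
    n.\<close>
  have "(\<lambda>n. (real (averaging_time b n) * (2 / n) - (?\<sigma> n)\<^sup>2) / ?\<sigma> n - b) \<longlonglongrightarrow> 0"
  proof (rule Lim_null_comparison)
    show "\<forall>\<^sub>F n in sequentially.
        norm ((real (averaging_time b n) * (2 / n) - (?\<sigma> n)\<^sup>2) / ?\<sigma> n - b) \<le> 2 / n / ?\<sigma> n"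
      using averaging_time_approx[of b] pos
    proof eventually_elim
      case (elim n)
      let ?K = "real (averaging_time b n)"
      let ?d = "?K - real n * ((?\<sigma> n)\<^sup>2 + b * ?\<sigma> n) / 2"
      have d: "\<bar>?d\<bar> \<le> 1" using elim by simp
      have "(?K * (2 / n) - (?\<sigma> n)\<^sup>2) / ?\<sigma> n - b = ?d * (2 / n) / ?\<sigma> n"
        using elim by (intro scal) auto
      also have "norm \<dots> = \<bar>?d\<bar> * (2 / n) / ?\<sigma> n"
        using elim by (simp only: real_norm_def abs_mult abs_divide) simp
      also have "\<dots> \<le> 1 * (2 / n) / ?\<sigma> n"
        using elim by (intro divide_right_mono mult_right_mono d) auto
      finally show ?case by simp
    qed
    show "(\<lambda>n. 2 / real n / ?\<sigma> n) \<longlonglongrightarrow> 0" by real_asymp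
  qed
  then have "(\<lambda>n. (real (averaging_time b n) * (2 / n) - (?\<sigma> n)\<^sup>2) / ?\<sigma> n) \<longlonglongrightarrow> b"
    by (simp add: LIM_zero_iff)
  moreover have "\<forall>\<^sub>F n in sequentially. 2 / real n \<in> {0..1}"
    using eventually_ge_at_top[of 2] by eventually_elim simp
  moreover have "(\<lambda>n. 2 / real n) \<longlonglongrightarrow> 0" by real_asymp
  ultimately have "weak_conv_m (\<lambda>n. distr (measure_pmf (binomial_pmf (averaging_time b n) (2 / n))) borel
      (\<lambda>m. (real m - (?\<sigma> n)\<^sup>2) / ?\<sigma> n - b)) std_normal_distribution"
    by (intro binomial_weak_conv filterlim_sqrt_log2)
  then have "(\<lambda>n. cdf (distr (measure_pmf (binomial_pmf (averaging_time b n) (2 / n))) borel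
      (\<lambda>m. (real m - (?\<sigma> n)\<^sup>2) / ?\<sigma> n - b)) (u - b)) \<longlonglongrightarrow> cdf std_normal_distribution (u - b)"
    unfolding weak_conv_m_def weak_conv_def using isCont_cdf_std_normal by blast
  moreover have cdf_distr: "cdf (distr (measure_pmf q) borel (\<lambda>m. g m - b)) (u - b) = measure_pmf.prob q {m. g m \<le> u}"
    for q :: "nat pmf" and g
    unfolding cdf_def by (subst measure_distr) (simp_all add: vimage_def)
  ultimately show ?thesis
  proof (elim Lim_transform_eventually)
    show "\<forall>\<^sub>F n in sequentially. cdf (distr (measure_pmf (binomial_pmf (averaging_time b n) (2 / n))) borel
        (\<lambda>m. (real m - (?\<sigma> n)\<^sup>2) / ?\<sigma> n - b)) (u - b)
      = measure_pmf.prob (binomial_pmf (averaging_time b n) (2 / n)) {m. real m \<le> log 2 (real n) + u * ?\<sigma> n}"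
      using pos
    proof eventually_elim
      case (elim n)
      have iff: "(real m - (?\<sigma> n)\<^sup>2) / ?\<sigma> n \<le> u \<longleftrightarrow> real m \<le> log 2 (real n) + u * ?\<sigma> n" for m
      proof -
        have pos: "0 < ?\<sigma> n" and sq: "(?\<sigma> n)\<^sup>2 = log 2 (real n)" using elim by simp_all
        show ?thesis unfolding pos_divide_le_eq[OF pos] sq by (rule iffI) linarith+
      qed
      show ?case unfolding cdf_distr iff ..
    qed
  qed
qed

section \<open>Transfer from the probability space to finite means over paths\<close>

section \<open>The law of the chain\<close>

lemma rev_map_upt_eq_iff:
  "rev (map f [0..<k]) = ps \<longleftrightarrow> length ps = k \<and> (\<forall>i<k. f i = rev ps ! i)"
  unfolding rev_swap list_eq_iff_nth_eq[of "map f _"] by auto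

lemma (in prob_space) prob_path_eq:
  assumes n: "2 \<le> n" and indep: "indep_vars (\<lambda>_. count_space UNIV) P UNIV"
    and distr: "\<And>k. distr M (count_space UNIV) (P k) = measure_pmf (pmf_of_set (distinct_pairs n))"
    and ps: "set ps \<subseteq> distinct_pairs n" "length ps = k"
  shows "prob {\<omega> \<in> space M. rev (map (\<lambda>i. P i \<omega>) [0..<k]) = ps} = 1 / real (card (distinct_pairs n)) ^ k"
proof (cases "k = 0")
  \<comment> \<open>The empty list is separate because the product formula below needs a nonempty
    index set.\<close>
  case True
  then show ?thesis using ps prob_space by simp
next
  case False
  have meas: "random_variable (count_space UNIV) (P i)" for i
    using indep by (simp add: indep_vars_def2)
  have "{\<omega> \<in> space M. rev (map (\<lambda>i. P i \<omega>) [0..<k]) = ps}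
      = (\<Inter>i\<in>{..<k}. P i -` {rev ps ! i} \<inter> space M)"
    using ps(2) False unfolding rev_map_upt_eq_iff by auto
  also have "prob \<dots> = (\<Prod>i\<in>{..<k}. prob (P i -` {rev ps ! i} \<inter> space M))"
    using False by (intro indep_varsD[OF indep]) auto
  also have "\<dots> = (\<Prod>i\<in>{..<k}. 1 / real (card (distinct_pairs n)))"
  proof (intro prod.cong refl)
    fix i assume "i \<in> {..<k}"
    then have "rev ps ! i \<in> distinct_pairs n"
      using ps nth_mem[of i "rev ps"] by auto
    moreover have "prob (P i -` {rev ps ! i} \<inter> space M) = measure (distr M (count_space UNIV) (P i)) {rev ps ! i}"
      using meas by (subst measure_distr) auto
    ultimately show "prob (P i -` {rev ps ! i} \<inter> space M) = 1 / real (card (distinct_pairs n))"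
      using card_distinct_pairs_pos[OF n] unfolding distr
      by (simp add: measure_pmf_single card_gt_0_iff)
  qed
  finally show ?thesis by (simp add: power_divide)
qed

text \<open>The state is a function of the first \<open>k\<close> picks, and lists of picks form a
  countable type. Every event about the state is thus a countable union of path events, so
  \<open>Q\<close> can be arbitrary.\<close>

lemma chain_prob_eq:
  assumes n: "2 \<le> n" and chain: "repeated_averaging_chain n start_vector M X"
  shows "measure M {\<omega> \<in> space M. Q (X k \<omega>)} = path_mean n k (\<lambda>ps. of_bool (Q (run start_vector ps)))"
proof -
  from chain interpret prob_space M by (simp add: repeated_averaging_chain_def)
  obtain P where indep: "indep_vars (\<lambda>_. count_space UNIV) P UNIV"
    and distr: "\<And>k. distr M (count_space UNIV) (P k) = measure_pmf (pmf_of_set (distinct_pairs n))"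
    and X0: "\<And>\<omega>. \<omega> \<in> space M \<Longrightarrow> X 0 \<omega> = start_vector"
    and XS: "\<And>k \<omega>. \<omega> \<in> space M \<Longrightarrow> X (Suc k) \<omega> = average_pair (P k \<omega>) (X k \<omega>)"
    using chain unfolding repeated_averaging_chain_def by blast
  have meas: "random_variable (count_space UNIV) (P i)" for i
    using indep by (simp add: indep_vars_def2)
  define R where "R \<omega> = rev (map (\<lambda>i. P i \<omega>) [0..<k])" for \<omega>
  have X: "X k \<omega> = run start_vector (R \<omega>)" if "\<omega> \<in> space M" for \<omega>
    unfolding R_def using that by (induction k) (simp_all add: X0 XS run_def)
  have sets: "{\<omega> \<in> space M. R \<omega> = ps} \<in> events" for ps
  proof (cases "length ps = k")
    case True
    then have "{\<omega> \<in> space M. R \<omega> = ps} = {\<omega> \<in> space M. \<forall>i<k. P i \<omega> = rev ps ! i}"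
      unfolding R_def rev_map_upt_eq_iff by simp
    also have "\<dots> \<in> events" using meas by measurable
    finally show ?thesis .
  next
    case False
    then have "{\<omega> \<in> space M. R \<omega> = ps} = {}" unfolding R_def rev_map_upt_eq_iff by simp
    then show ?thesis using sets.empty_sets by (simp only:)
  qed
  let ?L = "{ps. set ps \<subseteq> distinct_pairs n \<and> length ps = k}"
  have prob_finite: "prob (\<Union>ps\<in>A. {\<omega> \<in> space M. R \<omega> = ps}) = card A / real (card (distinct_pairs n)) ^ k"
    if "A \<subseteq> ?L" for A
  proof -
    have "finite A" using that finite_paths by (rule finite_subset)
    then have "prob (\<Union>ps\<in>A. {\<omega> \<in> space M. R \<omega> = ps}) = (\<Sum>ps\<in>A. prob {\<omega> \<in> space M. R \<omega> = ps})"
      using sets by (intro finite_measure_finite_Union) (auto simp: disjoint_family_on_def)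
    also have "\<dots> = (\<Sum>ps\<in>A. 1 / real (card (distinct_pairs n)) ^ k)"
      unfolding R_def using that by (intro sum.cong refl prob_path_eq[OF n indep distr]) auto
    finally show ?thesis by simp
  qed
  \<comment> \<open>The admissible paths already carry probability 1, so picks outside
    \<open>distinct_pairs n\<close> occur only on a null set.\<close>
  have "card ?L = card (distinct_pairs n) ^ k"
    by (intro card_lists_length_eq) simp
  then have "prob (\<Union>ps\<in>?L. {\<omega> \<in> space M. R \<omega> = ps}) = 1"
    using card_distinct_pairs_pos[OF n] by (subst prob_finite) (simp_all add: card_gt_0_iff)
  then have ae: "AE \<omega> in M. R \<omega> \<in> ?L"
    using sets by (subst (asm) prob_eq_1) auto
  have "{\<omega> \<in> space M. Q (X k \<omega>)} = (\<Union>ps\<in>{ps. Q (run start_vector ps)}. {\<omega> \<in> space M. R \<omega> = ps})"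
    using X by auto
  also have "prob \<dots> = prob (\<Union>ps\<in>{ps \<in> ?L. Q (run start_vector ps)}. {\<omega> \<in> space M. R \<omega> = ps})"
  proof (rule finite_measure_eq_AE)
    show "AE \<omega> in M. (\<omega> \<in> (\<Union>ps\<in>{ps. Q (run start_vector ps)}. {\<omega> \<in> space M. R \<omega> = ps})) =
        (\<omega> \<in> (\<Union>ps\<in>{ps \<in> ?L. Q (run start_vector ps)}. {\<omega> \<in> space M. R \<omega> = ps}))"
      using ae by eventually_elim auto
  qed (auto intro!: sets.countable_UN' sets uncountable_def)
  also have "\<dots> = path_mean n k (\<lambda>ps. of_bool (Q (run start_vector ps)))"
  proof -
    have "(\<Sum>ps\<in>?L. of_bool (Q (run start_vector ps))) = (\<Sum>ps | ps \<in> ?L \<and> Q (run start_vector ps). 1 :: real)"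
      unfolding of_bool_def by (rule sum.inter_filter[symmetric]) (rule finite_paths)
    then show ?thesis unfolding path_mean_def by (subst prob_finite) auto
  qed
  finally show ?thesis .
qed

section \<open>Pathwise and mean bounds on the l1 distance, and tail inequalities\<close>

section \<open>Bounds on the distance to uniform\<close>

lemma sum_run_start:
  assumes "2 \<le> n" "set ps \<subseteq> distinct_pairs n"
  shows "(\<Sum>i=1..n. run start_vector ps i) = 1"
  using sum_run[OF assms(2), of start_vector] sum_start_vector[OF assms(1)] by simp

text \<open>For y = x - 1/n and any z at most the positive part of y, |y| >= 2 z - y, and the y sum
  to 0. Where weighted mass sits, x >= 2^(-\<mu>), so 1/n <= \<theta> x with \<theta> = 2^\<mu> / n,
  and z can be 1 - \<theta> times that mass.\<close>

lemma l1_dist_run_ge: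
  assumes n: "2 \<le> n" and ps: "set ps \<subseteq> distinct_pairs n"
    and w: "\<And>m. 0 \<le> w m" "\<And>m. w m \<le> 1" "\<And>m. w m \<noteq> 0 \<Longrightarrow> real m \<le> \<mu>"
  shows "2 * (1 - 2 powr \<mu> / n) * (\<Sum>i=1..n. weighted w ps i) \<le> l1_dist_uniform n (run start_vector ps)"
proof -
  let ?x = "run start_vector ps"
  define \<theta> where "\<theta> = 2 powr \<mu> / n"
  have le: "2 * (1 - \<theta>) * weighted w ps i - (?x i - 1 / n) \<le> \<bar>?x i - 1 / n\<bar>" for i
  proof (cases "weighted w ps i = 0 \<or> 1 < \<theta>")
    case True
    then have "(1 - \<theta>) * weighted w ps i \<le> 0"
      using weighted_nonneg[of w ps i, OF w(1)] by (auto intro: mult_nonpos_nonneg)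
    then show ?thesis unfolding mult.assoc by linarith
  next
    case False
    have "2 powr (- \<mu>) \<le> ?x i"
      using False by (intro weighted_nonzero_imp[where w = w] w(3)) auto
    then have "\<theta> * 2 powr (- \<mu>) \<le> \<theta> * ?x i" by (intro mult_left_mono) (auto simp: \<theta>_def)
    moreover have "\<theta> * 2 powr (- \<mu>) = 1 / n" by (simp add: \<theta>_def powr_minus)
    moreover have "(1 - \<theta>) * weighted w ps i \<le> (1 - \<theta>) * ?x i"
      using False by (intro mult_left_mono weighted_le_run w(2)) auto
    moreover have "(1 - \<theta>) * ?x i = ?x i - \<theta> * ?x i" by (simp add: left_diff_distrib)
    ultimately have "(1 - \<theta>) * weighted w ps i \<le> ?x i - 1 / n" by linarith
    then show ?thesis unfolding mult.assoc using abs_ge_self[of "?x i - 1 / n"] by linarith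
  qed
  have "(\<Sum>i=1..n. 2 * (1 - \<theta>) * weighted w ps i - (?x i - 1 / n)) \<le> l1_dist_uniform n ?x"
    unfolding l1_dist_uniform_def by (intro sum_mono le)
  moreover have "(\<Sum>i=1..n. ?x i - 1 / n) = 0"
    using n sum_run_start[OF n ps] by (simp add: sum_subtractf)
  ultimately show ?thesis unfolding \<theta>_def[symmetric] by (simp only: sum_subtractf sum_distrib_left)
qed

text \<open>The state after \<open>ps\<close> is 1 / n plus two zero-sum parts, from
  \<open>w\<close> and \<open>v\<close>. Averaging is linear, fixes constants and contracts l1, so
  the \<open>w\<close> part costs at most its mass plus as much again for centring; the
  \<open>v\<close> part is left for an l2 estimate.\<close>

lemma l1_dist_run_append_le:
  assumes n: "2 \<le> n" and ps: "set ps \<subseteq> distinct_pairs n" and qs: "set qs \<subseteq> distinct_pairs n"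
    and w: "\<And>m. 0 \<le> w m" "\<And>m. w m + v m = 1"
  shows "l1_dist_uniform n (run start_vector (qs @ ps)) \<le> 2 * (\<Sum>i=1..n. weighted w ps i)
    + (\<Sum>i=1..n. \<bar>run (\<lambda>i. weighted v ps i - (\<Sum>j=1..n. weighted v ps j) / n) qs i\<bar>)"
proof -
  define W where "W = (\<Sum>i=1..n. weighted w ps i)"
  define V where "V = (\<Sum>i=1..n. weighted v ps i)"
  let ?f = "\<lambda>i. weighted w ps i - W / n" and ?g = "\<lambda>i. weighted v ps i - V / n"
  have x: "run start_vector ps i = weighted w ps i + weighted v ps i" for i
    using weighted_add[of w v ps i] w(2) by (simp add: weighted_one)
  then have "W + V = 1"
    using sum_run_start[OF n ps] by (simp add: W_def V_def sum.distrib)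
  then have "W / n + V / n = 1 / n" by (metis add_divide_distrib)
  then have start: "run start_vector ps = (\<lambda>i. (?f i + ?g i) + 1 / n)"
    using x by (simp add: fun_eq_iff)
  have "l1_dist_uniform n (run start_vector (qs @ ps)) = (\<Sum>i=1..n. \<bar>run ?f qs i + run ?g qs i\<bar>)"
    unfolding l1_dist_uniform_def run_append start by (simp only: run_add run_const) simp
  also have "\<dots> \<le> (\<Sum>i=1..n. \<bar>run ?f qs i\<bar>) + (\<Sum>i=1..n. \<bar>run ?g qs i\<bar>)"
    unfolding sum.distrib[symmetric] by (intro sum_mono abs_triangle_ineq)
  also have "(\<Sum>i=1..n. \<bar>run ?f qs i\<bar>) \<le> (\<Sum>i=1..n. \<bar>?f i\<bar>)"
    by (rule sum_abs_run_le[OF qs])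
  also have "\<dots> \<le> (\<Sum>i=1..n. weighted w ps i + W / n)"
  proof (intro sum_mono)
    fix i
    have "0 \<le> weighted w ps i" "0 \<le> W / n"
      unfolding W_def by (auto intro!: weighted_nonneg w(1) sum_nonneg divide_nonneg_nonneg)
    then show "\<bar>?f i\<bar> \<le> weighted w ps i + W / n" by simp
  qed
  also have "\<dots> = 2 * W" using n by (simp add: sum.distrib W_def)
  finally show ?thesis unfolding W_def V_def by simp
qed

lemma sum_sq_centered_le: "(\<Sum>i=1..n. (f i - (\<Sum>j=1..n. f j) / n)\<^sup>2) \<le> (\<Sum>i=1..n. (f i)\<^sup>2)"
  for f :: "nat \<Rightarrow> real"
proof (cases "n = 0")
  case False
  define s where "s = (\<Sum>j=1..n. f j)"
  have "(\<Sum>i=1..n. (f i - s / n)\<^sup>2) = (\<Sum>i=1..n. (f i)\<^sup>2 - 2 * (s / n) * f i + (s / n)\<^sup>2)"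
    by (intro sum.cong refl) (simp add: power2_diff)
  also have "\<dots> = (\<Sum>i=1..n. (f i)\<^sup>2) - 2 * (s / n) * s + n * (s / n)\<^sup>2"
    unfolding s_def by (simp only: sum.distrib sum_subtractf flip: sum_distrib_left) simp
  also have "\<dots> = (\<Sum>i=1..n. (f i)\<^sup>2) - s\<^sup>2 / n"
    using False by (simp add: power2_eq_square)
  also have "\<dots> \<le> (\<Sum>i=1..n. (f i)\<^sup>2)" by simp
  finally show ?thesis by (simp add: s_def)
qed simp

lemma path_mean_sqrt_le:
  assumes n: "2 \<le> n" and "\<And>ps. 0 \<le> F ps"
  shows "path_mean n k (\<lambda>ps. sqrt (F ps)) \<le> sqrt (path_mean n k F)"
  using path_mean_sq_le[OF n, of k "\<lambda>ps. sqrt (F ps)"] assms(2) by (intro real_le_rsqrt) simp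

text \<open>The mass is split after \<open>k\<close> picks. During \<open>r\<close> further picks
  the \<open>v\<close> part contracts in l2; Cauchy-Schwarz and Jensen return this to a mean l1
  bound.\<close>

lemma path_mean_l1_dist_le:
  assumes n: "2 \<le> n" and w: "\<And>m. 0 \<le> w m" "\<And>m. w m + v m = 1" and v: "\<And>m. 0 \<le> v m"
  shows "path_mean n (r + k) (\<lambda>ps. l1_dist_uniform n (run start_vector ps))
    \<le> 2 * measure_pmf.expectation (binomial_pmf k (2 / n)) w
      + sqrt (real n * ((1 - 1 / (real n - 1)) ^ r *
          measure_pmf.expectation (binomial_pmf k (2 / n)) (\<lambda>m. v m * (1 / 2 ^ m + 1 / (real n - 1)))))"
proof -
  let ?q = "1 - 1 / (real n - 1)"
  let ?W = "\<lambda>ps. \<Sum>i=1..n. weighted w ps i"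
  let ?Q = "\<lambda>ps. \<Sum>i=1..n. run start_vector ps i * weighted v ps i"
  have q: "0 \<le> ?q" using n by simp
  have Q: "0 \<le> ?Q ps" for ps
    by (intro sum_nonneg mult_nonneg_nonneg run_start_nonneg weighted_nonneg v)
  have v1: "v m \<le> 1" for m using w(1)[of m] w(2)[of m] by linarith
  have "path_mean n (r + k) (\<lambda>ps. l1_dist_uniform n (run start_vector ps))
      \<le> path_mean n k (\<lambda>ps. 2 * ?W ps + sqrt (real n * (?q ^ r * ?Q ps)))"
    unfolding path_mean_append
  proof (rule path_mean_mono)
    fix ps assume ps: "set ps \<subseteq> distinct_pairs n"
    let ?u = "\<lambda>i. weighted v ps i - (\<Sum>j=1..n. weighted v ps j) / n"
    have "path_mean n r (\<lambda>qs. l1_dist_uniform n (run start_vector (qs @ ps)))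
        \<le> path_mean n r (\<lambda>qs. 2 * ?W ps + (\<Sum>i=1..n. \<bar>run ?u qs i\<bar>))"
      by (intro path_mean_mono l1_dist_run_append_le[OF n ps] w)
    also have "\<dots> = 2 * ?W ps + path_mean n r (\<lambda>qs. \<Sum>i=1..n. \<bar>run ?u qs i\<bar>)"
      by (simp only: path_mean_add path_mean_const[OF n])
    also have "path_mean n r (\<lambda>qs. \<Sum>i=1..n. \<bar>run ?u qs i\<bar>)
        \<le> sqrt (real n * (?q ^ r * (\<Sum>i=1..n. (?u i)\<^sup>2)))"
      using n by (intro path_mean_sum_abs_run_le) (simp_all add: sum_subtractf)
    also have "\<dots> \<le> sqrt (real n * (?q ^ r * ?Q ps))"
    proof (intro real_sqrt_le_mono mult_left_mono)
      have "(\<Sum>i=1..n. (?u i)\<^sup>2) \<le> (\<Sum>i=1..n. (weighted v ps i)\<^sup>2)"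
        by (rule sum_sq_centered_le)
      \<comment> \<open>Since v <= 1, one factor may be enlarged to the full coordinate, giving the
        quantity bounded by \<open>path_mean_sum_run_mult_weighted_le\<close>.\<close>
      also have "\<dots> \<le> ?Q ps"
        unfolding power2_eq_square
        by (intro sum_mono mult_right_mono weighted_le_run weighted_nonneg v v1)
      finally show "(\<Sum>i=1..n. (?u i)\<^sup>2) \<le> ?Q ps" .
    qed (use q in auto)
    finally show "path_mean n r (\<lambda>qs. l1_dist_uniform n (run start_vector (qs @ ps)))
        \<le> 2 * ?W ps + sqrt (real n * (?q ^ r * ?Q ps))" by simp
  qed
  also have "\<dots> = 2 * path_mean n k ?W + path_mean n k (\<lambda>ps. sqrt (real n * (?q ^ r * ?Q ps)))"
    by (simp only: path_mean_add path_mean_cmult)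
  also have "path_mean n k (\<lambda>ps. sqrt (real n * (?q ^ r * ?Q ps)))
      \<le> sqrt (path_mean n k (\<lambda>ps. real n * (?q ^ r * ?Q ps)))"
    using q Q by (intro path_mean_sqrt_le n mult_nonneg_nonneg zero_le_power) auto
  also have "path_mean n k (\<lambda>ps. real n * (?q ^ r * ?Q ps)) = real n * (?q ^ r * path_mean n k ?Q)"
    by (simp only: path_mean_cmult)
  also have "sqrt \<dots> \<le> sqrt (real n * (?q ^ r *
      measure_pmf.expectation (binomial_pmf k (2 / n)) (\<lambda>m. v m * (1 / 2 ^ m + 1 / (real n - 1)))))"
    using q by (intro real_sqrt_le_mono mult_left_mono path_mean_sum_run_mult_weighted_le n v) auto
  finally show ?thesis by (simp only: path_mean_sum_weighted[OF n])
qed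

lemma path_mean_chebyshev:
  assumes n: "2 \<le> n" and "0 < \<epsilon>"
  shows "path_mean n k (\<lambda>ps. of_bool (F ps \<le> path_mean n k F - \<epsilon>))
    \<le> 1 / \<epsilon>\<^sup>2 * (path_mean n k (\<lambda>ps. (F ps)\<^sup>2) - (path_mean n k F)\<^sup>2)"
proof -
  let ?c = "path_mean n k F"
  have "path_mean n k (\<lambda>ps. of_bool (F ps \<le> ?c - \<epsilon>))
      \<le> path_mean n k (\<lambda>ps. 1 / \<epsilon>\<^sup>2 * ((F ps)\<^sup>2 + (?c\<^sup>2 - 2 * ?c * F ps)))"
  proof (rule path_mean_mono)
    fix ps
    have eq: "(F ps)\<^sup>2 + (?c\<^sup>2 - 2 * ?c * F ps) = (?c - F ps)\<^sup>2"
      by (simp add: power2_diff)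
    have "of_bool (F ps \<le> ?c - \<epsilon>) * \<epsilon>\<^sup>2 \<le> (?c - F ps)\<^sup>2"
      using \<open>0 < \<epsilon>\<close> by (auto intro!: power_mono)
    then show "of_bool (F ps \<le> ?c - \<epsilon>) \<le> 1 / \<epsilon>\<^sup>2 * ((F ps)\<^sup>2 + (?c\<^sup>2 - 2 * ?c * F ps))"
      unfolding eq using \<open>0 < \<epsilon>\<close> by (simp add: pos_le_divide_eq)
  qed
  also have "\<dots> = 1 / \<epsilon>\<^sup>2 * (path_mean n k (\<lambda>ps. (F ps)\<^sup>2) + (?c\<^sup>2 - 2 * ?c * ?c))"
    by (simp only: path_mean_add path_mean_diff path_mean_cmult path_mean_const[OF n])
  finally show ?thesis by (simp add: power2_eq_square)
qed

text \<open>Markov's inequality for upper deviations. F - c + \<eta> is nonnegative unless F < c -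
  \<eta>, and there it is at least -c, which the indicator term compensates. So the mean and the
  lower tail together control the upper tail.\<close>

lemma path_mean_deviation_le:
  assumes n: "2 \<le> n" and "0 < \<epsilon>" "0 \<le> \<eta>" "0 \<le> c" and F: "\<And>ps. 0 \<le> F ps"
  shows "path_mean n k (\<lambda>ps. of_bool (\<epsilon> < \<bar>F ps - c\<bar>))
    \<le> path_mean n k (\<lambda>ps. of_bool (F ps < c - \<epsilon>))
      + 1 / \<epsilon> * (path_mean n k F - c + \<eta> + c * path_mean n k (\<lambda>ps. of_bool (F ps < c - \<eta>)))"
proof -
  have "path_mean n k (\<lambda>ps. of_bool (\<epsilon> < \<bar>F ps - c\<bar>))
      \<le> path_mean n k (\<lambda>ps. of_bool (F ps < c - \<epsilon>)
        + 1 / \<epsilon> * (F ps - c + \<eta> + c * of_bool (F ps < c - \<eta>)))"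
  proof (rule path_mean_mono)
    fix ps
    have "of_bool (c + \<epsilon> < F ps) * \<epsilon> \<le> F ps - c + \<eta> + c * of_bool (F ps < c - \<eta>)"
      using assms F[of ps] by (auto simp: of_bool_def)
    then have "of_bool (c + \<epsilon> < F ps) \<le> 1 / \<epsilon> * (F ps - c + \<eta> + c * of_bool (F ps < c - \<eta>))"
      using \<open>0 < \<epsilon>\<close> by (simp add: pos_le_divide_eq)
    moreover have "(of_bool (\<epsilon> < \<bar>F ps - c\<bar>) :: real) \<le> of_bool (F ps < c - \<epsilon>) + of_bool (c + \<epsilon> < F ps)"
      by (auto simp: of_bool_def)
    ultimately show "of_bool (\<epsilon> < \<bar>F ps - c\<bar>)
        \<le> of_bool (F ps < c - \<epsilon>) + 1 / \<epsilon> * (F ps - c + \<eta> + c * of_bool (F ps < c - \<eta>))"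
      by linarith
  qed
  also have "\<dots> = path_mean n k (\<lambda>ps. of_bool (F ps < c - \<epsilon>))
      + 1 / \<epsilon> * (path_mean n k F - c + \<eta> + c * path_mean n k (\<lambda>ps. of_bool (F ps < c - \<eta>)))"
    by (simp only: path_mean_add path_mean_diff path_mean_cmult path_mean_const[OF n])
  finally show ?thesis .
qed

lemma prob_binomial_eq_expectation:
  "measure_pmf.prob (binomial_pmf k p) {m. Q m} = measure_pmf.expectation (binomial_pmf k p) (\<lambda>m. of_bool (Q m))"
proof -
  have "(\<lambda>m. of_bool (Q m) :: real) = indicator {m. Q m}" by (auto simp: fun_eq_iff)
  then show ?thesis by simp
qed

lemma cdf_std_normal_near:
  assumes "0 < e"
  obtains \<delta> where "0 < \<delta>" "\<bar>cdf std_normal_distribution (x + c * \<delta>) - cdf std_normal_distribution x\<bar> < e"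
proof -
  obtain s where s: "0 < s" "\<And>y. \<bar>y - x\<bar> < s \<Longrightarrow> \<bar>cdf std_normal_distribution y - cdf std_normal_distribution x\<bar> < e"
    using isCont_cdf_std_normal[of x] assms unfolding continuous_at_eps_delta dist_real_def by metis
  have "\<bar>c * (s / (\<bar>c\<bar> + 1))\<bar> < s"
    using s(1) by (simp add: abs_mult abs_divide pos_divide_less_eq)
  then show thesis
    using s by (intro that[of "s / (\<bar>c\<bar> + 1)"] s(2)) (auto simp: add_pos_nonneg)
qed

section \<open>Lower deviations of the distance vanish\<close>

lemma lower_deviation_tendsto:
  assumes "0 < \<epsilon>"
  shows "(\<lambda>n. path_mean n (averaging_time a n)
      (\<lambda>ps. of_bool (l1_dist_uniform n (run start_vector ps) < 2 * cdf std_normal_distribution (- a) - \<epsilon>)))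
    \<longlonglongrightarrow> 0"
proof -
  let ?\<Phi> = "cdf std_normal_distribution"
  obtain \<delta> where \<delta>: "0 < \<delta>" "\<bar>?\<Phi> (- a + (- 2) * \<delta>) - ?\<Phi> (- a)\<bar> < \<epsilon> / 8"
    by (rule cdf_std_normal_near[of "\<epsilon> / 8" "- a" "- 2"], use assms in simp)
  let ?\<sigma> = "\<lambda>n::nat. sqrt (log 2 (real n))"
  \<comment> \<open>\<open>h n\<close> is 1 up to log2 n - 2 \<delta> \<sigma> and falls linearly to
    0 at log2 n - \<delta> \<sigma>, so its Lipschitz constant is 1 / (\<delta> \<sigma>).\<close>
  define h where "h n m = max 0 (min 1 ((log 2 (real n) - \<delta> * ?\<sigma> n - real m) / (\<delta> * ?\<sigma> n)))" for n m
  \<comment> \<open>The variance bound for this Lipschitz constant, of order 1 / log2 n; the 1 added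
    to the time covers rounding.\<close>
  define V where "V n = 4 * (1 / (\<delta> * ?\<sigma> n))\<^sup>2 / n
      * ((real n * (log 2 (real n) + a * ?\<sigma> n) / 2 + 1) / n + n)" for n :: nat
  have V: "(\<lambda>n. 1 / (\<epsilon> / 8)\<^sup>2 * V n) \<longlonglongrightarrow> 0"
    unfolding V_def using \<delta>(1) assms by real_asymp
  have "(\<lambda>n. 2 powr (- (\<delta> * ?\<sigma> n))) \<longlonglongrightarrow> 0" using \<delta>(1) by real_asymp
  then have \<theta>: "\<forall>\<^sub>F n in sequentially. 2 powr (- (\<delta> * ?\<sigma> n)) < \<epsilon> / 8"
    using assms by (intro order_tendstoD) auto
  have arg: "- 2 * \<delta> - a = - a + - 2 * \<delta>" by simp
  have "?\<Phi> (- a) - \<epsilon> / 8 < ?\<Phi> (- 2 * \<delta> - a)"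
    unfolding arg using \<delta>(2) by linarith
  then have mean: "\<forall>\<^sub>F n in sequentially. ?\<Phi> (- a) - \<epsilon> / 8 <
      measure_pmf.prob (binomial_pmf (averaging_time a n) (2 / n)) {m. real m \<le> log 2 (real n) + - 2 * \<delta> * ?\<sigma> n}"
    by (rule order_tendstoD[OF binomial_averaging_time_tendsto])
  have pos: "\<forall>\<^sub>F n in sequentially. 0 < ?\<sigma> n"
    by (rule filterlim_sqrt_log2[unfolded filterlim_at_top_dense, rule_format])
  have upper: "\<forall>\<^sub>F n in sequentially. path_mean n (averaging_time a n)
      (\<lambda>ps. of_bool (l1_dist_uniform n (run start_vector ps) < 2 * ?\<Phi> (- a) - \<epsilon>)) \<le> 1 / (\<epsilon> / 8)\<^sup>2 * V n"
    using \<theta> mean pos averaging_time_approx[of a] eventually_ge_at_top[of 2]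
  proof eventually_elim
    case (elim n)
    note n = elim(5)
    let ?K = "averaging_time a n" and ?S = "\<lambda>ps. \<Sum>i=1..n. weighted (h n) ps i"
    define d where "d = \<delta> * ?\<sigma> n"
    have d: "0 < d" using \<delta>(1) elim(3) by (simp add: d_def)
    have h_eq: "h n m = max 0 (min 1 ((log 2 (real n) - d - real m) / d))" for m
      unfolding h_def d_def ..
    have h01: "0 \<le> h n m" "h n m \<le> 1" for m unfolding h_eq by auto
    have h_supp: "real m \<le> log 2 (real n) - d" if "h n m \<noteq> 0" for m
    proof (rule ccontr)
      assume "\<not> real m \<le> log 2 (real n) - d"
      then have "(log 2 (real n) - d - real m) / d \<le> 0" using d by (intro divide_nonpos_pos) auto
      then show False using that unfolding h_eq by auto
    qed
    have h_lip: "\<bar>h n m - h n (Suc m)\<bar> \<le> 1 / d" for m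
    proof -
      have "(log 2 (real n) - d - real m) / d - (log 2 (real n) - d - real (Suc m)) / d = 1 / d"
        unfolding diff_divide_distrib[symmetric] by simp
      moreover have "0 < 1 / d" using d by simp
      ultimately show ?thesis unfolding h_eq by linarith
    qed
    have h_ge: "of_bool (real m \<le> log 2 (real n) + - 2 * \<delta> * ?\<sigma> n) \<le> h n m" for m
    proof (cases "real m \<le> log 2 (real n) + - 2 * \<delta> * ?\<sigma> n")
      case True
      then have "d \<le> log 2 (real n) - d - real m" unfolding d_def by (simp add: mult.assoc)
      then have "1 \<le> (log 2 (real n) - d - real m) / d" using d by (simp add: pos_le_divide_eq)
      then show ?thesis unfolding h_eq by auto
    qed (simp add: h01)
    have p: "2 / real n \<in> {0..1}" using n by simp
    have "measure_pmf.prob (binomial_pmf ?K (2 / n)) {m. real m \<le> log 2 (real n) + - 2 * \<delta> * ?\<sigma> n}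
        \<le> measure_pmf.expectation (binomial_pmf ?K (2 / n)) (h n)"
      unfolding prob_binomial_eq_expectation
      by (intro integral_mono integrable_binomial_pmf p h_ge)
    then have mean_S: "?\<Phi> (- a) - \<epsilon> / 8 < path_mean n ?K ?S"
      using elim(2) unfolding path_mean_sum_weighted[OF n] by linarith
    have "path_mean n ?K (\<lambda>ps. of_bool (l1_dist_uniform n (run start_vector ps) < 2 * ?\<Phi> (- a) - \<epsilon>))
        \<le> path_mean n ?K (\<lambda>ps. of_bool (?S ps \<le> path_mean n ?K ?S - \<epsilon> / 8))"
    proof (rule path_mean_mono)
      fix ps assume ps: "set ps \<subseteq> distinct_pairs n"
      have "2 powr (log 2 (real n) - d) / n = 2 powr (- d)"
        using n by (simp add: powr_diff powr_minus field_simps)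
      then have "2 * (1 - 2 powr (- d)) * ?S ps \<le> l1_dist_uniform n (run start_vector ps)"
        using l1_dist_run_ge[OF n ps h01 h_supp] by simp
      moreover have "2 powr (- d) * ?S ps \<le> 2 powr (- d)"
      proof -
        have "?S ps \<le> 1"
          using sum_mono[of "{1..n}" "weighted (h n) ps" "run start_vector ps"]
            weighted_le_run[of "h n" ps, OF h01(2)] sum_run_start[OF n ps] by auto
        then show ?thesis using mult_left_mono[of "?S ps" 1 "2 powr (- d)"] by simp
      qed
      moreover have "2 * (1 - 2 powr (- d)) * ?S ps = 2 * ?S ps - 2 * (2 powr (- d) * ?S ps)"
        by (simp add: algebra_simps)
      ultimately have "2 * ?S ps - 2 * 2 powr (- d) \<le> l1_dist_uniform n (run start_vector ps)"
        by linarith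
      \<comment> \<open>A distance below 2 \<Phi>(-a) - \<epsilon> forces S < \<Phi>(-a) -
        \<epsilon>/2 + \<epsilon>/8, while the mean of S exceeds \<Phi>(-a) - \<epsilon>/8: the gap
        is above \<epsilon>/8.\<close>
      then have "?S ps \<le> path_mean n ?K ?S - \<epsilon> / 8"
        if "l1_dist_uniform n (run start_vector ps) < 2 * ?\<Phi> (- a) - \<epsilon>"
        using that mean_S elim(1) assms unfolding d_def by linarith
      then show "(of_bool (l1_dist_uniform n (run start_vector ps) < 2 * ?\<Phi> (- a) - \<epsilon>) :: real)
          \<le> of_bool (?S ps \<le> path_mean n ?K ?S - \<epsilon> / 8)"
        by auto
    qed
    also have "\<dots> \<le> 1 / (\<epsilon> / 8)\<^sup>2 * (path_mean n ?K (\<lambda>ps. (?S ps)\<^sup>2) - (path_mean n ?K ?S)\<^sup>2)"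
      using assms by (intro path_mean_chebyshev n) simp
    also have "\<dots> \<le> 1 / (\<epsilon> / 8)\<^sup>2 * V n"
    proof (rule mult_left_mono)
      have "path_mean n ?K (\<lambda>ps. (?S ps)\<^sup>2) - (path_mean n ?K ?S)\<^sup>2
          \<le> 4 * (1 / d)\<^sup>2 / n * (\<Sum>t<?K. path_mean n t (\<lambda>ps. \<Sum>i=1..n. (run start_vector ps i)\<^sup>2))"
        by (rule variance_sum_weighted_le[where w = "h n", OF n h_lip])
      also have "\<dots> \<le> 4 * (1 / d)\<^sup>2 / n * (real ?K / n + n)"
        by (intro mult_left_mono sum_path_mean_sum_sq_run_start_le n) simp
      also have "\<dots> \<le> 4 * (1 / d)\<^sup>2 / n * ((real n * (log 2 (real n) + a * ?\<sigma> n) / 2 + 1) / n + n)"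
        using elim(4) by (intro mult_left_mono add_right_mono divide_right_mono) auto
      finally show "path_mean n ?K (\<lambda>ps. (?S ps)\<^sup>2) - (path_mean n ?K ?S)\<^sup>2 \<le> V n"
        unfolding V_def d_def .
    qed simp
    finally show ?case .
  qed
  have lower: "0 \<le> path_mean n k (\<lambda>ps. of_bool (Q ps))" for n k Q
    unfolding path_mean_def by (intro divide_nonneg_nonneg sum_nonneg) auto
  show ?thesis
    by (rule tendsto_sandwich[OF _ upper tendsto_const V]) (simp add: lower)
qed

section \<open>Asymptotic upper bound for the mean distance\<close>

lemma exp_minus_powr_tendsto: "((\<lambda>x::real. exp (1 - x) * (2 powr x + 2)) \<longlongrightarrow> 0) at_top"
proof (rule Lim_null_comparison)
  show "\<forall>\<^sub>F x::real in at_top. norm (exp (1 - x) * (2 powr x + 2)) \<le> exp (1 - x) * (exp (3 / 4 * x) + 2)"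
    using eventually_ge_at_top[of 0]
  proof eventually_elim
    case (elim x)
    \<comment> \<open>A constant strictly between ln 2 and 1 is wanted; with 3/4 the leading product
      is exp (1 - x / 4).\<close>
    have "ln 2 \<le> (3 / 4 :: real)" using ln2_le_25_over_36 by linarith
    then have "2 powr x \<le> exp (3 / 4 * x)"
      using mult_right_mono[of "ln 2" "3 / 4" x] elim by (simp add: powr_def mult.commute)
    then show ?case by (simp add: abs_mult)
  qed
  show "((\<lambda>x::real. exp (1 - x) * (exp (3 / 4 * x) + 2)) \<longlongrightarrow> 0) at_top" by real_asymp
qed

lemma path_mean_l1_dist_eventually_le:
  assumes "0 < \<eta>"
  shows "\<forall>\<^sub>F n in sequentially. path_mean n (averaging_time a n) (\<lambda>ps. l1_dist_uniform n (run start_vector ps))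
    \<le> 2 * cdf std_normal_distribution (- a) + \<eta>"
proof -
  let ?\<Phi> = "cdf std_normal_distribution"
  \<comment> \<open>The cutoff -\<delta>/2 and the splitting time index b = a - \<delta> give the
    normal argument -\<delta>/2 - b = -a + \<delta>/2.\<close>
  obtain \<delta> where \<delta>: "0 < \<delta>" "\<bar>?\<Phi> (- a + 1 / 2 * \<delta>) - ?\<Phi> (- a)\<bar> < \<eta> / 4"
    by (rule cdf_std_normal_near[of "\<eta> / 4" "- a" "1 / 2"], use assms in simp)
  let ?\<sigma> = "\<lambda>n::nat. sqrt (log 2 (real n))"
  define b where "b = a - \<delta>" \<comment> \<open>\<open>averaging_time b n\<close> is where heavy and light mass are separated\<close>
  \<comment> \<open>With x = \<delta> \<sigma> / 2, n times the mean squared l2 norm of the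
    \<open>v\<close> part is at most 2^x + 2, and the roughly n x remaining picks contract it by at
    most exp (1 - x), where the 1 absorbs rounding.\<close>
  define B where "B n = sqrt (exp (1 - \<delta> / 2 * ?\<sigma> n) * (2 powr (\<delta> / 2 * ?\<sigma> n) + 2))" for n :: nat
  have "filterlim (\<lambda>n. \<delta> / 2 * ?\<sigma> n) at_top sequentially"
    using \<delta>(1) by (intro filterlim_tendsto_pos_mult_at_top[OF tendsto_const _ filterlim_sqrt_log2]) simp
  from tendsto_real_sqrt[OF filterlim_compose[OF exp_minus_powr_tendsto this]]
  have "B \<longlonglongrightarrow> 0" unfolding B_def by simp
  then have B: "\<forall>\<^sub>F n in sequentially. B n < \<eta> / 2"
    using assms by (intro order_tendstoD) auto
  have arg: "- (\<delta> / 2) - b = - a + 1 / 2 * \<delta>" by (simp add: b_def)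
  have "?\<Phi> (- (\<delta> / 2) - b) < ?\<Phi> (- a) + \<eta> / 4"
    unfolding arg using \<delta>(2) by linarith
  then have mean: "\<forall>\<^sub>F n in sequentially. measure_pmf.prob (binomial_pmf (averaging_time b n) (2 / n))
      {m. real m \<le> log 2 (real n) + - (\<delta> / 2) * ?\<sigma> n} < ?\<Phi> (- a) + \<eta> / 4"
    by (rule order_tendstoD[OF binomial_averaging_time_tendsto])
  have pos: "\<forall>\<^sub>F n in sequentially. 0 < ?\<sigma> n"
    by (rule filterlim_sqrt_log2[unfolded filterlim_at_top_dense, rule_format])
  have gap: "\<forall>\<^sub>F n in sequentially. 0 < real n * (\<delta> * ?\<sigma> n) / 2 - 2"
    using \<delta>(1) by real_asymp
  show ?thesis
    using B mean pos gap averaging_time_approx[of a] averaging_time_approx[of b] eventually_ge_at_top[of 2]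
  proof eventually_elim
    case (elim n)
    note n = elim(7)
    let ?K = "averaging_time a n" and ?k = "averaging_time b n" and ?q = "1 - 1 / (real n - 1)"
    define x where "x = \<delta> / 2 * ?\<sigma> n"
    define \<mu> where "\<mu> = log 2 (real n) + - (\<delta> / 2) * ?\<sigma> n"
    have \<mu>: "\<mu> = log 2 (real n) - x" by (simp add: \<mu>_def x_def)
    define r where "r = ?K - ?k"
    define w where "w m = (of_bool (real m \<le> \<mu>) :: real)" for m
    define v where "v m = (of_bool (\<mu> < real m) :: real)" for m
    let ?E = "measure_pmf.expectation (binomial_pmf ?k (2 / n))"
    have p: "2 / real n \<in> {0..1}" using n by simp
    have "real n * (log 2 (real n) + a * ?\<sigma> n) / 2 - real n * (log 2 (real n) + b * ?\<sigma> n) / 2 = real n * x"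
      unfolding b_def x_def by (simp add: field_simps)
    \<comment> \<open>Each of the two floors is off by at most 1.\<close>
    then have K: "real n * x - 2 \<le> real ?K - real ?k" using elim(5,6) by linarith
    have nx: "0 < real n * x - 2" using elim(4) by (simp add: x_def mult_ac)
    have K_eq: "?K = r + ?k" and r: "real n * x - 2 \<le> real r"
      using K nx unfolding r_def by (auto simp: of_nat_diff)
    have Ew: "?E w < ?\<Phi> (- a) + \<eta> / 4"
      using elim(2) unfolding prob_binomial_eq_expectation w_def \<mu>_def .
    have "?E (\<lambda>m. v m * (1 / 2 ^ m + 1 / (real n - 1))) \<le> ?E (\<lambda>_. 2 powr (- \<mu>) + 1 / (real n - 1))"
    proof (intro integral_mono integrable_binomial_pmf p)
      fix m
      have "1 / 2 ^ m \<le> 2 powr (- \<mu>)" if "\<mu> < real m"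
      proof -
        have "2 powr (- real m) \<le> 2 powr (- \<mu>)" using that by (intro powr_mono) auto
        then show ?thesis by (simp add: powr_minus_divide powr_realpow)
      qed
      then show "v m * (1 / 2 ^ m + 1 / (real n - 1)) \<le> 2 powr (- \<mu>) + 1 / (real n - 1)"
        using n by (auto simp: v_def)
    qed
    then have Ev: "?E (\<lambda>m. v m * (1 / 2 ^ m + 1 / (real n - 1))) \<le> 2 powr (- \<mu>) + 1 / (real n - 1)"
      by simp
    have q: "0 \<le> ?q" using n by simp
    have "?q ^ r \<le> exp (- 1 / n) ^ r"
    proof (intro power_mono q)
      have "?q \<le> 1 + - 1 / n" using n by (simp add: field_simps)
      also have "\<dots> \<le> exp (- 1 / n)" by (rule exp_ge_add_one_self)
      finally show "?q \<le> exp (- 1 / n)" .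
    qed
    also have "\<dots> = exp (- real r / n)" by (simp add: exp_of_nat_mult[symmetric])
    also have "\<dots> \<le> exp (1 - x)"
    proof -
      have "(real n * x - 2) / n \<le> real r / n" using r by (intro divide_right_mono) auto
      then have "x - 2 / n \<le> real r / n" using n by (simp add: diff_divide_distrib)
      moreover have "2 / real n \<le> 1" using n by simp
      ultimately show ?thesis by simp
    qed
    finally have qr: "?q ^ r \<le> exp (1 - x)" .
    have "2 powr (- \<mu>) = 2 powr x / n"
      unfolding \<mu> using n by (simp add: powr_diff)
    then have "real n * (2 powr (- \<mu>) + 1 / (real n - 1)) = 2 powr x + n / (real n - 1)"
      using n by (simp add: distrib_left)
    also have "\<dots> \<le> 2 powr x + 2" using n by (simp add: pos_divide_le_eq)
    finally have nE: "real n * (2 powr (- \<mu>) + 1 / (real n - 1)) \<le> 2 powr x + 2" .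
    have "real n * (?q ^ r * ?E (\<lambda>m. v m * (1 / 2 ^ m + 1 / (real n - 1))))
        \<le> real n * (?q ^ r * (2 powr (- \<mu>) + 1 / (real n - 1)))"
      using q by (intro mult_left_mono Ev) auto
    also have "\<dots> = ?q ^ r * (real n * (2 powr (- \<mu>) + 1 / (real n - 1)))"
      by (rule mult.left_commute)
    also have "\<dots> \<le> exp (1 - x) * (2 powr x + 2)"
      using n by (intro mult_mono qr nE) auto
    finally have "sqrt (real n * (?q ^ r * ?E (\<lambda>m. v m * (1 / 2 ^ m + 1 / (real n - 1))))) \<le> B n"
      unfolding B_def x_def by (rule real_sqrt_le_mono)
    moreover have "path_mean n ?K (\<lambda>ps. l1_dist_uniform n (run start_vector ps))
        \<le> 2 * ?E w + sqrt (real n * (?q ^ r * ?E (\<lambda>m. v m * (1 / 2 ^ m + 1 / (real n - 1)))))"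
      unfolding K_eq by (rule path_mean_l1_dist_le[OF n]) (auto simp: w_def v_def)
    ultimately show ?case using Ew elim(1) by linarith
  qed
qed

section \<open>Convergence in probability from the lower tail and the mean\<close>

theorem theorem1p2:
  fixes M :: "nat \<Rightarrow> 'a measure"
    and X :: "nat \<Rightarrow> nat \<Rightarrow> 'a \<Rightarrow> nat \<Rightarrow> real"
    and a :: real
  assumes "\<And>n. n \<ge> 2 \<Longrightarrow> repeated_averaging_chain n start_vector (M n) (X n)"
  shows "tendsto_in_probability M
           (\<lambda>n \<omega>. l1_dist_uniform n (X n (averaging_time a n) \<omega>))
           (2 * cdf std_normal_distribution (- a))"
  unfolding tendsto_in_probability_def
proof (intro allI impI)
  fix \<epsilon> :: real assume \<epsilon>: "0 < \<epsilon>"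
  define c where "c = 2 * cdf std_normal_distribution (- a)"
  have c: "0 \<le> c" unfolding c_def cdf_def by simp
  let ?T = "\<lambda>n ps. l1_dist_uniform n (run start_vector ps)"
  let ?E = "\<lambda>n. path_mean n (averaging_time a n)"
  have T: "0 \<le> ?T n ps" for n ps by (simp add: l1_dist_uniform_def sum_nonneg)
  have eq: "measure (M n) {\<omega> \<in> space (M n). \<epsilon> < \<bar>l1_dist_uniform n (X n (averaging_time a n) \<omega>) - c\<bar>}
      = ?E n (\<lambda>ps. of_bool (\<epsilon> < \<bar>?T n ps - c\<bar>))" if "2 \<le> n" for n
    by (rule chain_prob_eq[OF that assms[OF that]])
  have "(\<lambda>n. ?E n (\<lambda>ps. of_bool (\<epsilon> < \<bar>?T n ps - c\<bar>))) \<longlonglongrightarrow> 0"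
  proof (rule tendstoI)
    fix e :: real assume e: "0 < e"
    \<comment> \<open>The mean excess, \<eta> itself and the lower-tail term are each at most
      \<eta>, and 3 \<eta> / \<epsilon> = e / 2; the other half of e is for the lower deviation by
      \<epsilon>.\<close>
    define \<eta> where "\<eta> = e * \<epsilon> / 6"
    have \<eta>: "0 < \<eta>" using e \<epsilon> by (simp add: \<eta>_def)
    have lower: "(\<lambda>n. ?E n (\<lambda>ps. of_bool (?T n ps < c - x))) \<longlonglongrightarrow> 0" if "0 < x" for x
      unfolding c_def by (rule lower_deviation_tendsto[OF that])
    have "\<forall>\<^sub>F n in sequentially. ?E n (\<lambda>ps. of_bool (?T n ps < c - \<epsilon>)) < e / 2"
      using e by (intro order_tendstoD[OF lower[OF \<epsilon>]]) simp
    moreover have "\<forall>\<^sub>F n in sequentially. c * ?E n (\<lambda>ps. of_bool (?T n ps < c - \<eta>)) < \<eta>"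
      using \<eta> tendsto_mult[OF tendsto_const[of c] lower[OF \<eta>]] by (intro order_tendstoD) simp_all
    moreover have "\<forall>\<^sub>F n in sequentially. ?E n (?T n) \<le> c + \<eta>"
      unfolding c_def by (rule path_mean_l1_dist_eventually_le[OF \<eta>])
    ultimately show "\<forall>\<^sub>F n in sequentially. dist (?E n (\<lambda>ps. of_bool (\<epsilon> < \<bar>?T n ps - c\<bar>))) 0 < e"
      using eventually_ge_at_top[of 2]
    proof eventually_elim
      case (elim n)
      have "1 / \<epsilon> * (?E n (?T n) - c + \<eta> + c * ?E n (\<lambda>ps. of_bool (?T n ps < c - \<eta>))) \<le> 1 / \<epsilon> * (3 * \<eta>)"
        using elim \<epsilon> by (intro mult_left_mono) auto
      also have "\<dots> = e / 2" using \<epsilon> by (simp add: \<eta>_def)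
      finally have "?E n (\<lambda>ps. of_bool (\<epsilon> < \<bar>?T n ps - c\<bar>)) < e"
        using elim(1) path_mean_deviation_le[where F = "?T n" and k = "averaging_time a n",
            OF elim(4) \<epsilon> less_imp_le[OF \<eta>] c T]
        by linarith
      moreover have "0 \<le> ?E n (\<lambda>ps. of_bool (\<epsilon> < \<bar>?T n ps - c\<bar>))"
        unfolding path_mean_def by (intro divide_nonneg_nonneg sum_nonneg) auto
      ultimately show ?case by simp
    qed
  qed
  then show "(\<lambda>n. measure (M n) {\<omega> \<in> space (M n).
      \<epsilon> < \<bar>l1_dist_uniform n (X n (averaging_time a n) \<omega>) - 2 * cdf std_normal_distribution (- a)\<bar>}) \<longlonglongrightarrow> 0"
    unfolding c_def[symmetric]
    by (rule Lim_transform_eventually) (use eq in \<open>auto intro: eventually_sequentiallyI[of 2]\<close>)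
qed

end
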